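(* Any plus-welded knotoid diagram can be transformed into a trivial knotoid diagram by crossing changes (used together with the moves generating plus-welded equivalence); that is, by a finite sequence of crossing changes and moves $\Omega_1$–$\Omega_3$, $V\Omega_1$–$V\Omega_4$, $\Omega_v$, $\Phi_{\text{over}}$, $\Phi_+$.
   Context: Diagrams. A (plus-welded, or virtual) knotoid diagram is a generic immersion of $[0,1]$ into $S^2$ with finitely many transverse double points, each of which is either a classical crossing (with over/under information) or a virtual crossing (also called a welded crossing). The images of $0$ (the tail) and $1$ (the head) are distinct from each other and from the crossings. The diagram is oriented from tail to head. A trivial knotoid diagram is an embedding of $[0,1]$. Moves. Moves are local changes in a small disc, and are always considered together with isotopies of $S^2$. $\Omega_1,\Omega_2,\Omega_3$: the classical Reidemeister moves, performed away from the endpoints. $V\Omega_1,V\Omega_2,V\Omega_3$: the same with all crossings virtual. $V\Omega_4$: an arc having two virtual crossings is moved across a classical crossing. $\Omega_v$: a segment adjacent to the head or the tail is slid back or forward through a transversal strand, deleting or creating a virtual crossing. $\Phi_{\text{over}}$: an arc that is the over-strand at two classical crossings is moved across a virtual crossing. $\Phi_+$: a segment adjacent to the head or the tail is pulled over a transversal strand, deleting or creating a classical crossing at which this end segment is the over-strand. Plus-welded knotoids are equivalence classes of diagrams under these moves. A crossing change exchanges the over and under strands at a classical crossing. *)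

theory Defs
  imports "HOL-Analysis.Analysis"
begin

abbreviation S2 :: "(real^3) set" where
  "S2 \<equiv> sphere 0 1"

section \<open>Diagrams\<close>

text \<open>
  The oriented curve is parametrised by \<open>{0..1}\<close>, with tail at 0 and head at 1; its values elsewhere
  are irrelevant. A crossing is recorded by its two preimages: \<open>(s, t) \<in> over\<close> says that
  the crossing with parameters \<open>s \<noteq> t\<close> is classical and that the strand through \<open>s\<close> is the upper
  one. A double point not recorded in \<open>over\<close> is a virtual crossing.
\<close>

record diagram =
  curve :: "real \<Rightarrow> real^3"
  over :: "(real \<times> real) set"

definition double_points :: "(real \<Rightarrow> 'a) \<Rightarrow> (real \<times> real) set" where
  "double_points \<gamma> = {(s, t). s \<in> {0..1} \<and> t \<in> {0..1} \<and> s \<noteq> t \<and> \<gamma> s = \<gamma> t}"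

abbreviation velocity :: "(real \<Rightarrow> real^3) \<Rightarrow> real \<Rightarrow> real^3" where
  "velocity \<gamma> t \<equiv> vector_derivative \<gamma> (at t within {0..1})"

text \<open>\<open>D n\<close> is the \<open>n\<close>-th derivative, one-sided at the endpoints.\<close>

definition smooth_curve :: "(real \<Rightarrow> real^3) \<Rightarrow> bool" where
  "smooth_curve \<gamma> \<longleftrightarrow>
     (\<exists>D :: nat \<Rightarrow> real \<Rightarrow> real^3. D 0 = \<gamma> \<and>
        (\<forall>n. \<forall>t\<in>{0..1}. (D n has_vector_derivative D (Suc n) t) (at t within {0..1})))"

definition immersed_curve :: "(real \<Rightarrow> real^3) \<Rightarrow> bool" where
  "immersed_curve \<gamma> \<longleftrightarrow>
     \<gamma> ` {0..1} \<subseteq> S2 \<and> smooth_curve \<gamma> \<and> (\<forall>t\<in>{0..1}. velocity \<gamma> t \<noteq> 0)"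

text \<open>Transversality at a double point is linear independence of the two velocities.\<close>

definition generic_immersion :: "(real \<Rightarrow> real^3) \<Rightarrow> bool" where
  "generic_immersion \<gamma> \<longleftrightarrow>
     immersed_curve \<gamma> \<and>
     finite (double_points \<gamma>) \<and>
     (\<forall>s t. (s, t) \<in> double_points \<gamma> \<longrightarrow> \<not> collinear {0, velocity \<gamma> s, velocity \<gamma> t}) \<and>
     (\<forall>s t u. (s, t) \<in> double_points \<gamma> \<and> (s, u) \<in> double_points \<gamma> \<longrightarrow> t = u)"

definition knotoid_diagram :: "diagram \<Rightarrow> bool" where
  "knotoid_diagram d \<longleftrightarrow>
     generic_immersion (curve d) \<and>
     curve d 0 \<noteq> curve d 1 \<and>
     (\<forall>t. (0, t) \<notin> double_points (curve d) \<and> (1, t) \<notin> double_points (curve d)) \<and>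
     over d \<subseteq> double_points (curve d) \<and>
     (\<forall>s t. (s, t) \<in> over d \<longrightarrow> (t, s) \<notin> over d)"

definition trivial_diagram :: "diagram \<Rightarrow> bool" where
  "trivial_diagram d \<longleftrightarrow> knotoid_diagram d \<and> inj_on (curve d) {0..1}"

definition over_crossing :: "diagram \<Rightarrow> real \<times> real \<Rightarrow> bool" where
  "over_crossing d c \<longleftrightarrow> c \<in> over d"

definition virtual_crossing :: "diagram \<Rightarrow> real \<times> real \<Rightarrow> bool" where
  "virtual_crossing d c \<longleftrightarrow>
     c \<in> double_points (curve d) \<and> c \<notin> over d \<and> prod.swap c \<notin> over d"

section \<open>Isotopy and crossing change\<close>

text \<open>Ambient isotopy of the sphere, up to orientation-preserving reparametrisation of the curve.\<close>

definition isotopic :: "diagram \<Rightarrow> diagram \<Rightarrow> bool" where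
  "isotopic d e \<longleftrightarrow>
     (\<exists>h \<rho>. homotopic_with_canon (\<lambda>f. \<exists>g. homeomorphism S2 S2 f g) S2 S2 id h \<and>
        strict_mono_on {0..1} \<rho> \<and> \<rho> ` {0..1} = {0..1 :: real} \<and>
        (\<forall>t\<in>{0..1}. curve e t = h (curve d (\<rho> t))) \<and>
        over e = {(s, t). s \<in> {0..1} \<and> t \<in> {0..1} \<and> (\<rho> s, \<rho> t) \<in> over d})"

definition crossing_change :: "diagram \<Rightarrow> diagram \<Rightarrow> bool" where
  "crossing_change d e \<longleftrightarrow>
     knotoid_diagram d \<and> knotoid_diagram e \<and>
     (\<forall>t\<in>{0..1}. curve e t = curve d t) \<and>
     (\<exists>s t. (s, t) \<in> over d \<and> over e = insert (t, s) (over d - {(s, t)}))"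

section \<open>Local moves\<close>

definition disc_with_boundary :: "(real^3) set \<Rightarrow> (real^3) set \<Rightarrow> bool" where
  "disc_with_boundary B K \<longleftrightarrow>
     B \<subseteq> S2 \<and>
     (\<exists>f g. homeomorphism (cball (0 :: real^2) 1) B f g \<and> K = f ` sphere 0 1)"

text \<open>
  \<open>P\<close>, a disjoint union of closed intervals, is the set of parameters at which either curve lies in
  the disc. The curves meet the boundary circle exactly in the endpoints of these intervals (other
  than the tail and the head), and not in crossings. Outside the disc the diagrams coincide.
\<close>

definition differ_in_disc :: "real set \<Rightarrow> diagram \<Rightarrow> diagram \<Rightarrow> bool" where
  "differ_in_disc P d e \<longleftrightarrow>
     (\<exists>B K. disc_with_boundary B K \<and>
        (\<forall>x\<in>{d, e}.
           {t \<in> {0..1}. curve x t \<in> B} = P \<and>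
           {t \<in> {0..1}. curve x t \<in> K} = frontier P - {0, 1} \<and>
           (\<forall>s\<in>frontier P. \<forall>t. (s, t) \<notin> double_points (curve x)))) \<and>
     (\<forall>t\<in>{0..1} - P. curve d t = curve e t) \<and>
     over d - P \<times> P = over e - P \<times> P"

definition strand :: "real set \<Rightarrow> bool" where
  "strand J \<longleftrightarrow> (\<exists>a b. 0 < a \<and> a < b \<and> b < 1 \<and> J = {a..b})"

definition end_segment :: "real set \<Rightarrow> bool" where
  "end_segment T \<longleftrightarrow> (\<exists>c. 0 < c \<and> c < 1 \<and> (T = {0..c} \<or> T = {c..1}))"

text \<open>
  \<open>C\<close> lists each crossing inside the disc once, with one of its two orderings of parameters.
\<close>

definition crossings_inside :: "real set \<Rightarrow> diagram \<Rightarrow> (real \<times> real) set \<Rightarrow> bool" where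
  "crossings_inside P d C \<longleftrightarrow> double_points (curve d) \<inter> P \<times> P = C \<union> converse C"

text \<open>
  In the move schemes below, the parameters \<open>k\<close>, \<open>k12\<close>, \dots prescribe the kind of the crossings
  involved. In a disc, the arcs and the prescribed crossings determine the local picture up to
  isotopy. The first three schemes are stated in the direction which creates crossings.
\<close>

definition kink_move :: "(diagram \<Rightarrow> real \<times> real \<Rightarrow> bool) \<Rightarrow> diagram \<Rightarrow> diagram \<Rightarrow> bool" where
  "kink_move k d e \<longleftrightarrow>
     (\<exists>J c. strand J \<and> differ_in_disc J d e \<and>
        crossings_inside J d {} \<and>
        crossings_inside J e {c} \<and> k e c)"

definition bigon_move :: "(diagram \<Rightarrow> real \<times> real \<Rightarrow> bool) \<Rightarrow> diagram \<Rightarrow> diagram \<Rightarrow> bool" where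
  "bigon_move k d e \<longleftrightarrow>
     (\<exists>J1 J2 c c'. strand J1 \<and> strand J2 \<and> J1 \<inter> J2 = {} \<and>
        differ_in_disc (J1 \<union> J2) d e \<and>
        crossings_inside (J1 \<union> J2) d {} \<and>
        c \<in> J1 \<times> J2 \<and> c' \<in> J1 \<times> J2 \<and> c \<noteq> c' \<and>
        crossings_inside (J1 \<union> J2) e {c, c'} \<and> k e c \<and> k e c')"

definition end_move :: "(diagram \<Rightarrow> real \<times> real \<Rightarrow> bool) \<Rightarrow> diagram \<Rightarrow> diagram \<Rightarrow> bool" where
  "end_move k d e \<longleftrightarrow>
     (\<exists>T J c. end_segment T \<and> strand J \<and> T \<inter> J = {} \<and>
        differ_in_disc (T \<union> J) d e \<and>
        crossings_inside (T \<union> J) d {} \<and>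
        c \<in> T \<times> J \<and> crossings_inside (T \<union> J) e {c} \<and> k e c)"

text \<open>
  Three arcs cross pairwise exactly once, with crossings \<open>(s12, s21)\<close> of the first and second arc,
  and so on. Moving one arc across the crossing of the other two reverses the order in which
  the crossings are met along each of the arcs.
\<close>

definition triangle_move ::
  "(diagram \<Rightarrow> real \<times> real \<Rightarrow> bool) \<Rightarrow> (diagram \<Rightarrow> real \<times> real \<Rightarrow> bool) \<Rightarrow>
   (diagram \<Rightarrow> real \<times> real \<Rightarrow> bool) \<Rightarrow> diagram \<Rightarrow> diagram \<Rightarrow> bool" where
  "triangle_move k12 k13 k23 d e \<longleftrightarrow>
     (\<exists>J1 J2 J3 s12 s21 s13 s31 s23 s32 t12 t21 t13 t31 t23 t32.
        strand J1 \<and> strand J2 \<and> strand J3 \<and>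
        J1 \<inter> J2 = {} \<and> J1 \<inter> J3 = {} \<and> J2 \<inter> J3 = {} \<and>
        differ_in_disc (J1 \<union> J2 \<union> J3) d e \<and>
        {s12, s13, t12, t13} \<subseteq> J1 \<and> {s21, s23, t21, t23} \<subseteq> J2 \<and> {s31, s32, t31, t32} \<subseteq> J3 \<and>
        crossings_inside (J1 \<union> J2 \<union> J3) d {(s12, s21), (s13, s31), (s23, s32)} \<and>
        crossings_inside (J1 \<union> J2 \<union> J3) e {(t12, t21), (t13, t31), (t23, t32)} \<and>
        k12 d (s12, s21) \<and> k13 d (s13, s31) \<and> k23 d (s23, s32) \<and>
        k12 e (t12, t21) \<and> k13 e (t13, t31) \<and> k23 e (t23, t32) \<and>
        (s12 < s13 \<longleftrightarrow> t13 < t12) \<and> (s21 < s23 \<longleftrightarrow> t23 < t21) \<and> (s31 < s32 \<longleftrightarrow> t32 < t31))"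

definition "Omega1 = kink_move over_crossing"
definition "Omega2 = bigon_move over_crossing"
definition "Omega3 = triangle_move over_crossing over_crossing over_crossing"
definition "VOmega1 = kink_move virtual_crossing"
definition "VOmega2 = bigon_move virtual_crossing"
definition "VOmega3 = triangle_move virtual_crossing virtual_crossing virtual_crossing"
definition "VOmega4 = triangle_move virtual_crossing virtual_crossing over_crossing"
definition "Omega_v = end_move virtual_crossing"
definition "Phi_over = triangle_move over_crossing over_crossing virtual_crossing"
definition "Phi_plus = end_move over_crossing"

definition plus_welded_move :: "diagram \<Rightarrow> diagram \<Rightarrow> bool" where
  "plus_welded_move d e \<longleftrightarrow>
     knotoid_diagram d \<and> knotoid_diagram e \<and>
     (\<exists>m \<in> {isotopic, Omega1, Omega2, Omega3, VOmega1, VOmega2, VOmega3, VOmega4,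
             Omega_v, Phi_over, Phi_plus}. m d e \<or> m e d)"

end

theory Submission
  imports Defs
begin

text \<open>
  The head is retracted along the curve itself. Let \<open>d\<^sub>x\<close> be the part of the diagram
  up to the parameter \<open>x\<close>. If \<open>m\<close> is not the later parameter of a crossing, then \<open>d\<^sub>y\<close> for \<open>y \<ge> m\<close>
  close to \<open>m\<close> is isotopic to some \<open>d\<^sub>x\<close> with \<open>x < m\<close>, by an isotopy supported in a small
  neighbourhood of the point at \<open>m\<close>, where the curve is the graph of a function. If \<open>m\<close> is the later
  parameter of a crossing, then for \<open>y > m\<close> close to \<open>m\<close> the end of \<open>d\<^sub>y\<close> is pulled back through
  that crossing inside a small spherical cap: this is \<open>\<Omega>\<^sub>v\<close> if the crossing is virtual, and \<open>\<Phi>\<^sub>+\<close>,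
  after a crossing change if the end is the lower strand, otherwise. Since \<open>d\<^sub>x\<close> is embedded for small \<open>x\<close>,
  a supremum argument shows that \<open>d\<^sub>1\<close> can be trivialised. No other move is needed.
\<close>

section \<open>Smooth reparametrisations\<close>

text \<open>Isotopies and moves make different demands, and this shapes the two retractions.
  \<open>isotopic\<close> admits homeomorphisms and monotone reparametrisations, so the isotopy
  between crossings may use a tent-shaped bump; yet diagrams must be smooth and generic. These
  properties are not verified for images under an isotopy: every curve produced is
  \<open>\<gamma>\<close> after an increasing change of parameter, so once rescaled to the form
  \<open>\<gamma> (x * t)\<close> it inherits them from \<open>\<gamma>\<close>. A move instead
  requires the two parametrised curves to agree pointwise outside the disc. At a crossing the
  retracted curve is therefore \<open>\<gamma>\<close> after a smooth change of parameter that is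
  the identity up to the entry into the disc, built from exp(-1/x). The disc must meet the diagram
  in exactly one end segment and one strand. The curvature of the sphere provides this: along any
  curve in it, the height in the direction of the crossing point rises strictly to its maximum there
  and then falls strictly, however the strands bend.\<close>

definition smooth01 :: "(real \<Rightarrow> 'a::real_normed_vector) \<Rightarrow> bool" where
  "smooth01 f \<longleftrightarrow>
     (\<exists>D :: nat \<Rightarrow> real \<Rightarrow> 'a. D 0 = f \<and>
        (\<forall>n. \<forall>t\<in>{0..1}. (D n has_vector_derivative D (Suc n) t) (at t within {0..1})))"

text \<open>A choice of derivative maps \<open>F\<close> into itself and can be iterated. Smoothness
  thus reduces to finding a family closed under differentiation, with no formula for the n-th
  derivative.\<close>

lemma smooth01_coinduct:
  assumes "f \<in> F"
    and step: "\<And>g. g \<in> F \<Longrightarrow> \<exists>g'\<in>F. \<forall>t\<in>{0..1}. (g has_vector_derivative g' t) (at t within {0..1})"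
  shows "smooth01 f"
proof -
  obtain N where N: "\<And>g. g \<in> F \<Longrightarrow> N g \<in> F"
    "\<And>g t. g \<in> F \<Longrightarrow> t \<in> {0..1} \<Longrightarrow> (g has_vector_derivative N g t) (at t within {0..1})"
    using step by metis
  have "(N ^^ n) f \<in> F" for n
    by (induction n) (use N assms in auto)
  then show ?thesis
    unfolding smooth01_def using N(2)
    by (intro exI[of _ "\<lambda>n. (N ^^ n) f"]) auto
qed

lemma smooth01_compose:
  fixes f :: "real \<Rightarrow> 'a::real_normed_vector" and \<phi> :: "real \<Rightarrow> real"
  assumes "smooth01 f" "smooth01 \<phi>" and ran: "\<phi> ` {0..1} \<subseteq> {0..1}"
  shows "smooth01 (\<lambda>t. f (\<phi> t))"
proof -
  obtain D where D: "D 0 = f"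
    "\<And>n t. t \<in> {0..1} \<Longrightarrow> (D n has_vector_derivative D (Suc n) t) (at t within {0..1})"
    using assms(1) unfolding smooth01_def by blast
  obtain E where E: "E 0 = \<phi>"
    "\<And>n t. t \<in> {0..1} \<Longrightarrow> (E n has_vector_derivative E (Suc n) t) (at t within {0..1})"
    using assms(2) unfolding smooth01_def by blast
  have chain: "((\<lambda>t. D k (\<phi> t)) has_vector_derivative (E 1 t *\<^sub>R D (Suc k) (\<phi> t))) (at t within {0..1})"
    if "t \<in> {0..1}" for k t
  proof -
    have "(\<phi> has_vector_derivative E 1 t) (at t within {0..1})" using E(2)[OF that, of 0] E(1) by simp
    moreover have "(D k has_vector_derivative D (Suc k) (\<phi> t)) (at (\<phi> t) within \<phi> ` {0..1})"
      using D(2)[of "\<phi> t" k] ran that by (meson has_vector_derivative_within_subset image_subset_iff)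
    ultimately show ?thesis
      using vector_diff_chain_within[of \<phi> "E 1 t" t "{0..1}" "D k"] by (simp add: o_def)
  qed
  \<comment> \<open>the span of the terms in the formula of Faa di Bruno\<close>
  define F where "F = \<Inter>{G. (\<forall>k. (\<lambda>t. D k (\<phi> t)) \<in> G) \<and> (\<forall>j. \<forall>g\<in>G. (\<lambda>t. E j t *\<^sub>R g t) \<in> G) \<and>
       (\<forall>g\<in>G. \<forall>h\<in>G. (\<lambda>t. g t + h t) \<in> G)}"
  have F1: "(\<lambda>t. D k (\<phi> t)) \<in> F" for k unfolding F_def by blast
  have F2: "(\<lambda>t. E j t *\<^sub>R g t) \<in> F" if "g \<in> F" for j g using that unfolding F_def by blast
  have F3: "(\<lambda>t. g t + h t) \<in> F" if "g \<in> F" "h \<in> F" for g h using that unfolding F_def by auto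
  \<comment> \<open>Rule induction for \<open>F\<close>: the members with a derivative in
    \<open>F\<close> satisfy the three closure conditions again, so minimality of \<open>F\<close>
    gives \<open>F \<subseteq> G\<close>.\<close>
  define G where "G = {g\<in>F. \<exists>g'\<in>F. \<forall>t\<in>{0..1}. (g has_vector_derivative g' t) (at t within {0..1})}"
  have "F \<subseteq> G"
  proof -
    have "(\<lambda>t. D k (\<phi> t)) \<in> G" for k
      unfolding G_def
      by (intro CollectI conjI F1 bexI[where x="\<lambda>t. E 1 t *\<^sub>R D (Suc k) (\<phi> t)"] ballI chain F2)
    moreover have "(\<lambda>t. E j t *\<^sub>R g t) \<in> G" if asm: "g \<in> G" for j g
    proof -
      obtain g' where g: "g \<in> F" "g' \<in> F" "\<And>t. t\<in>{0..1} \<Longrightarrow> (g has_vector_derivative g' t) (at t within {0..1})"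
        using asm unfolding G_def by blast
      have "((\<lambda>t. E j t *\<^sub>R g t) has_vector_derivative (E j t *\<^sub>R g' t + E (Suc j) t *\<^sub>R g t)) (at t within {0..1})"
        if "t \<in> {0..1}" for t
        using has_vector_derivative_scaleR[OF _ g(3)[OF that]] E(2)[OF that, of j]
        by (simp add: has_real_derivative_iff_has_vector_derivative)
      then show ?thesis
        unfolding G_def
        by (intro CollectI conjI F2 g bexI[where x="\<lambda>t. E j t *\<^sub>R g' t + E (Suc j) t *\<^sub>R g t"] ballI F3)
    qed
    moreover have "(\<lambda>t. g t + h t) \<in> G" if asm: "g \<in> G" "h \<in> G" for g h
    proof -
      obtain g' h' where g: "g \<in> F" "g' \<in> F" "\<And>t. t\<in>{0..1} \<Longrightarrow> (g has_vector_derivative g' t) (at t within {0..1})"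
         and h: "h \<in> F" "h' \<in> F" "\<And>t. t\<in>{0..1} \<Longrightarrow> (h has_vector_derivative h' t) (at t within {0..1})"
        using asm unfolding G_def by blast
      show ?thesis
        unfolding G_def
        by (intro CollectI conjI F3 g h bexI[where x="\<lambda>t. g' t + h' t"] ballI has_vector_derivative_add)
    qed
    ultimately have "G \<in> {G. (\<forall>k. (\<lambda>t. D k (\<phi> t)) \<in> G) \<and> (\<forall>j. \<forall>g\<in>G. (\<lambda>t. E j t *\<^sub>R g t) \<in> G) \<and>
       (\<forall>g\<in>G. \<forall>h\<in>G. (\<lambda>t. g t + h t) \<in> G)}" by blast
    then show ?thesis unfolding F_def by blast
  qed
  then have "\<exists>g'\<in>F. \<forall>t\<in>{0..1}. (g has_vector_derivative g' t) (at t within {0..1})" if "g \<in> F" for g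
    using that unfolding G_def by auto
  with smooth01_coinduct[of "\<lambda>t. f (\<phi> t)" F] F1[of 0] D(1) show ?thesis by simp
qed

lemma smooth01_linear: "smooth01 (\<lambda>t::real. x * t :: real)"
proof -
  define F where "F = {\<lambda>t::real. x * t, \<lambda>_. x, \<lambda>_. 0 :: real}"
  have "\<exists>g'\<in>F. \<forall>t\<in>{0..1}. (g has_vector_derivative g' t) (at t within {0..1})" if "g \<in> F" for g
    using that unfolding F_def
    by (auto intro!: derivative_eq_intros simp flip: has_real_derivative_iff_has_vector_derivative)
  then show ?thesis
    by (intro smooth01_coinduct[of _ F]) (auto simp: F_def)
qed

text \<open>\<open>flat 1\<close> is the classical smooth function exp(-1/x), flat at 0. The
  polynomial in 1/x makes the family closed under differentiation.\<close>

definition flat :: "real poly \<Rightarrow> real \<Rightarrow> real" where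
  "flat p x = (if x > 0 then poly p (inverse x) * exp (- inverse x) else 0)"

lemma poly_exp_tendsto_0: "((\<lambda>z::real. poly p z * exp (- z)) \<longlongrightarrow> 0) at_top"
proof -
  have "((\<lambda>z::real. \<Sum>i\<le>degree p. coeff p i * (z ^ i / exp z)) \<longlongrightarrow> (\<Sum>i\<le>degree p. coeff p i * 0)) at_top"
    by (intro tendsto_sum tendsto_mult_left tendsto_power_div_exp_0)
  then show ?thesis
    by (simp add: poly_altdef sum_distrib_right exp_minus divide_inverse mult.assoc)
qed

text \<open>With z = 1/x one has dz/dx = -z^2, so p(z) exp(-z) has derivative z^2 (p - p')(z)
  exp(-z); \<open>[:0,0,1:]\<close> is z^2. At 0 the difference quotient from the right is z p(z)
  exp(-z), which tends to 0 as z grows.\<close>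

lemma flat_deriv:
  "(flat p has_real_derivative flat ([:0,0,1:] * (p - pderiv p)) x) (at x)"
proof -
  consider "x > 0" | "x < 0" | "x = 0" by linarith
  then show ?thesis
  proof cases
    case 1
    have "((\<lambda>x. poly p (inverse x) * exp (- inverse x)) has_real_derivative
        flat ([:0,0,1:] * (p - pderiv p)) x) (at x)"
    proof -
      have i: "(inverse has_real_derivative - (inverse x)\<^sup>2) (at x)"
        using DERIV_inverse[of x] 1 by (simp add: numeral_2_eq_2)
      have "((\<lambda>x. exp (- inverse x)) has_real_derivative exp (- inverse x) * (inverse x)\<^sup>2) (at x)"
        using DERIV_chain2[OF DERIV_exp DERIV_minus[OF i]] by simp
      from DERIV_mult[OF DERIV_chain2[OF poly_DERIV i] this]
      show ?thesis
        using 1 by (auto simp: flat_def algebra_simps power2_eq_square)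
    qed
    then show ?thesis
      by (rule has_field_derivative_transform_within_open[of _ _ _ "{0<..}"])
         (use 1 in \<open>auto simp: flat_def\<close>)
  next
    case 2
    show ?thesis
      by (rule has_field_derivative_transform_within_open[of "\<lambda>_. 0" _ _ "{..<0}"])
         (use 2 in \<open>auto simp: flat_def\<close>)
  next
    case 3
    have "((\<lambda>y. flat p y / y) \<longlongrightarrow> 0) (at_right 0)"
    proof -
      have "((\<lambda>y. poly (pCons 0 p) (inverse y) * exp (- inverse y)) \<longlongrightarrow> 0) (at_right (0::real))"
        using filterlim_compose[OF poly_exp_tendsto_0 filterlim_inverse_at_top_right] .
      then show ?thesis
        by (rule Lim_transform_eventually)
           (auto simp: flat_def divide_inverse eventually_at_right_less intro!: eventually_at_rightI[of 0 1])
    qed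
    moreover have "((\<lambda>y. flat p y / y) \<longlongrightarrow> 0) (at_left 0)"
      by (rule Lim_transform_eventually[OF tendsto_const])
         (auto simp: flat_def intro!: eventually_at_leftI[of "-1" 0])
    ultimately have "((\<lambda>y. flat p y / y) \<longlongrightarrow> 0) (at 0)"
      by (simp add: filterlim_at_split)
    then show ?thesis
      using 3 by (simp add: has_field_derivative_iff flat_def)
  qed
qed

text \<open>Subtracting a small multiple of \<open>flat 1 (t - c)\<close> leaves
  \<open>t \<le> c\<close> untouched, stays smooth at \<open>c\<close>, and moves every later
  parameter back.\<close>

lemma pull_back_exists:
  fixes c :: real
  assumes "0 < c" "c < 1"
  obtains \<sigma> \<sigma>' :: "real \<Rightarrow> real" where "smooth01 \<sigma>"
    "\<And>t. (\<sigma> has_real_derivative \<sigma>' t) (at t)" "\<And>t. t \<in> {0..1} \<Longrightarrow> \<sigma>' t > 0"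
    "\<And>t. t \<le> c \<Longrightarrow> \<sigma> t = t" "\<And>t. t > c \<Longrightarrow> \<sigma> t < t"
proof -
  \<comment> \<open>Differentiation of \<open>flat p\<close>, expressed on the polynomial
    \<open>p\<close>.\<close>
  define s where "s = (\<lambda>p::real poly. [:0,0,1:] * (p - pderiv p))"
  have "continuous_on {-1..1} (flat (s 1))"
    by (intro continuous_at_imp_continuous_on ballI DERIV_isCont[OF flat_deriv])
  then have "bounded (flat (s 1) ` {-1..1})"
    by (intro compact_imp_bounded compact_continuous_image compact_Icc)
  then obtain B where B: "B > 0" "\<And>t. t \<in> {-1..1} \<Longrightarrow> \<bar>flat (s 1) t\<bar> \<le> B"
    unfolding bounded_pos by auto
  \<comment> \<open>For \<open>t\<close> in \<open>{0..1}\<close> the argument \<open>t - c\<close>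
    lies in \<open>{-1..1}\<close>, where \<open>B\<close> bounds the derivative of
    \<open>flat 1\<close>; hence \<open>\<sigma>'\<close> is at least 1/2 there.\<close>
  define K where "K = 1 / (2 * B)"
  define \<sigma> where "\<sigma> = (\<lambda>t. t - K * flat 1 (t - c))"
  define \<sigma>' where "\<sigma>' = (\<lambda>t. 1 - K * flat (s 1) (t - c))"
  have fl: "((\<lambda>t. flat p (t - c)) has_real_derivative flat (s p) (t - c)) (at t)" for p t
    using DERIV_shift[of "flat p" "flat (s p) (t - c)" t "-c"] flat_deriv[of p "t - c"]
    unfolding s_def by simp
  have der: "(\<sigma> has_real_derivative \<sigma>' t) (at t)" for t
    unfolding \<sigma>_def \<sigma>'_def by (auto intro!: derivative_eq_intros fl)
  define F where "F = {\<sigma>, \<sigma>'} \<union> range (\<lambda>p t. - K * flat p (t - c))"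
  have FF: "\<exists>g'\<in>F. \<forall>t. (g has_real_derivative g' t) (at t)" if asm: "g \<in> F" for g
  proof -
    consider "g = \<sigma>" | "g = \<sigma>'" | p where "g = (\<lambda>t. - K * flat p (t - c))"
      using asm unfolding F_def by blast
    then show ?thesis
    proof cases
      case 1
      then show ?thesis
        by (intro bexI[of _ \<sigma>']) (auto simp: F_def der)
    next
      case 2
      have "(g has_real_derivative - K * flat (s (s 1)) (t - c)) (at t)" for t
        unfolding 2 \<sigma>'_def by (auto intro!: derivative_eq_intros fl)
      then show ?thesis
        by (intro bexI[of _ "\<lambda>t. - K * flat (s (s 1)) (t - c)"]) (auto simp: F_def)
    next
      case 3
      have "(g has_real_derivative - K * flat (s p) (t - c)) (at t)" for t
        unfolding 3 by (auto intro!: derivative_eq_intros fl)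
      then show ?thesis
        by (intro bexI[of _ "\<lambda>t. - K * flat (s p) (t - c)"]) (auto simp: F_def)
    qed
  qed
  then have "\<exists>g'\<in>F. \<forall>t\<in>{0..1}. (g has_vector_derivative g' t) (at t within {0..1})" if asm: "g \<in> F" for g
  proof -
    obtain g' where "g' \<in> F" "\<And>t. (g has_real_derivative g' t) (at t)"
      using FF[OF asm] by blast
    then show ?thesis
      by (intro bexI[of _ g'])
         (auto simp flip: has_real_derivative_iff_has_vector_derivative intro: has_field_derivative_at_within)
  qed
  then have "smooth01 \<sigma>"
    using smooth01_coinduct[of \<sigma> F] by (simp add: F_def)
  moreover have "\<sigma>' t > 0" if "t \<in> {0..1}" for t
  proof -
    have "K * flat (s 1) (t - c) \<le> K * B"
      using B(2)[of "t - c"] that assms B(1) by (intro mult_left_mono) (auto simp: K_def)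
    also have "K * B = 1/2" using B(1) by (simp add: K_def)
    finally show ?thesis by (simp add: \<sigma>'_def)
  qed
  moreover have "K > 0" using B(1) by (simp add: K_def)
  ultimately show ?thesis
    using der by (intro that[of \<sigma> \<sigma>']) (auto simp: \<sigma>_def flat_def)
qed

section \<open>Initial parts of a diagram\<close>

definition proper_curve :: "(real \<Rightarrow> real^3) \<Rightarrow> bool" where
  "proper_curve \<gamma> \<longleftrightarrow> generic_immersion \<gamma> \<and> \<gamma> 0 \<noteq> \<gamma> 1 \<and>
     (\<forall>t. (0, t) \<notin> double_points \<gamma> \<and> (1, t) \<notin> double_points \<gamma>)"

lemma knotoid_diagram_iff:
  "knotoid_diagram d \<longleftrightarrow> proper_curve (curve d) \<and> over d \<subseteq> double_points (curve d) \<and>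
     (\<forall>s t. (s, t) \<in> over d \<longrightarrow> (t, s) \<notin> over d)"
  unfolding knotoid_diagram_def proper_curve_def by blast

lemma double_points_sym: "(s, t) \<in> double_points \<gamma> \<Longrightarrow> (t, s) \<in> double_points \<gamma>"
  by (auto simp: double_points_def)

text \<open>The condition for cutting \<open>\<gamma>\<close> at \<open>x\<close>. Only earlier
  parameters are excluded: a crossing whose second passage comes after \<open>x\<close> disappears
  with the cut.\<close>

definition free_head :: "(real \<Rightarrow> real^3) \<Rightarrow> real \<Rightarrow> bool" where
  "free_head \<gamma> x \<longleftrightarrow> 0 < x \<and> x \<le> 1 \<and> (\<forall>s\<in>{0..<x}. \<gamma> s \<noteq> \<gamma> x)"

text \<open>The crossing data \<open>\<omega>\<close> refer to the rescaled parameter and are an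
  independent argument: crossing changes alter them while \<open>\<gamma>\<close> stays fixed, so
  later statements quantify over every \<open>\<omega>\<close>.\<close>

definition initial_part :: "(real \<Rightarrow> real^3) \<Rightarrow> real \<Rightarrow> (real \<times> real) set \<Rightarrow> diagram" where
  "initial_part \<gamma> x \<omega> = \<lparr>curve = (\<lambda>t. \<gamma> (x * t)), over = \<omega>\<rparr>"

lemma initial_part_simps [simp]:
  "curve (initial_part \<gamma> x \<omega>) = (\<lambda>t. \<gamma> (x * t))" "over (initial_part \<gamma> x \<omega>) = \<omega>"
  by (simp_all add: initial_part_def)

lemma smooth_curve_iff_smooth01: "smooth_curve \<gamma> \<longleftrightarrow> smooth01 \<gamma>"
  by (simp add: smooth_curve_def smooth01_def)

lemma smooth_curve_velocity:
  assumes "smooth_curve \<gamma>" "t \<in> {0..1}"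
  shows "(\<gamma> has_vector_derivative velocity \<gamma> t) (at t within {0..1})"
proof -
  obtain D where "(\<gamma> has_vector_derivative D t) (at t within {0..1})"
    using assms unfolding smooth_curve_def by metis
  then show ?thesis
    using vector_derivative_works differentiableI_vector by blast
qed

text \<open>An increasing \<open>\<phi>\<close> embeds the double points of the new curve into those
  of \<open>\<gamma>\<close>, and velocities are only scaled by positive factors, so genericity is
  inherited. The new head is the only point that needs a condition, namely
  \<open>head\<close>.\<close>

lemma proper_curve_compose:
  fixes \<phi> \<phi>' :: "real \<Rightarrow> real"
  assumes "proper_curve \<gamma>" "smooth01 \<phi>" and mono: "strict_mono_on {0..1} \<phi>"
    and der: "\<And>t. t \<in> {0..1} \<Longrightarrow> (\<phi> has_real_derivative \<phi>' t) (at t within {0..1})"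
    and pos: "\<And>t. t \<in> {0..1} \<Longrightarrow> \<phi>' t > 0"
    and "\<phi> 0 = 0" and head: "free_head \<gamma> (\<phi> 1)"
  shows "proper_curve (\<lambda>t. \<gamma> (\<phi> t))"
proof -
  define c where "c = (\<lambda>t. \<gamma> (\<phi> t))"
  have gen: "generic_immersion \<gamma>" and imm: "immersed_curve \<gamma>" and sm: "smooth_curve \<gamma>"
    using assms(1) by (auto simp: proper_curve_def generic_immersion_def immersed_curve_def)
  have less: "\<phi> s < \<phi> t" if "0 \<le> s" "s < t" "t \<le> 1" for s t
    using mono that by (auto simp: strict_mono_on_def)
  have ran: "\<phi> t \<in> {0..1}" if "t \<in> {0..1}" for t
    using less[of 0 t] less[of t 1] that head \<open>\<phi> 0 = 0\<close>
    by (cases "t = 0"; cases "t = 1") (auto simp: free_head_def)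
  have inj: "inj_on \<phi> {0..1}"
    using mono strict_mono_on_imp_inj_on by blast
  have dp: "(\<phi> s, \<phi> t) \<in> double_points \<gamma>" if "(s, t) \<in> double_points c" for s t
    using that ran inj_onD[OF inj, of s t] unfolding double_points_def c_def by blast
  have ab: "s \<in> {0..1} \<and> t \<in> {0..1}" if "(s, t) \<in> double_points c" for s t
    using that by (auto simp: double_points_def)
  have vel: "velocity c t = \<phi>' t *\<^sub>R velocity \<gamma> (\<phi> t)" if "t \<in> {0..1}" for t
  proof -
    have "(\<gamma> has_vector_derivative velocity \<gamma> (\<phi> t)) (at (\<phi> t) within \<phi> ` {0..1})"
      using smooth_curve_velocity[OF sm ran[OF that]] ran
      by (meson has_vector_derivative_within_subset image_subsetI)
    then have "(c has_vector_derivative \<phi>' t *\<^sub>R velocity \<gamma> (\<phi> t)) (at t within {0..1})"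
      using vector_diff_chain_within[of \<phi> "\<phi>' t" t "{0..1}" \<gamma>] der[OF that]
      by (simp add: c_def o_def has_real_derivative_iff_has_vector_derivative)
    then show ?thesis
      using that by (intro vector_derivative_within_closed_interval) auto
  qed
  have "finite (double_points c)"
  proof (rule inj_on_finite[of "map_prod \<phi> \<phi>"])
    show "inj_on (map_prod \<phi> \<phi>) (double_points c)"
      by (rule inj_on_subset[OF map_prod_inj_on[OF inj inj]]) (use ab in auto)
    show "map_prod \<phi> \<phi> ` double_points c \<subseteq> double_points \<gamma>"
      using dp by auto
    show "finite (double_points \<gamma>)"
      using gen by (simp add: generic_immersion_def)
  qed
  moreover have "smooth_curve c"
    using smooth01_compose[of \<gamma> \<phi>] assms(2) sm image_subsetI[of "{0..1}" \<phi>, OF ran]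
    by (simp add: c_def smooth_curve_iff_smooth01)
  moreover have "velocity c t \<noteq> 0" if "t \<in> {0..1}" for t
    using imm ran[OF that] pos[OF that] vel[OF that] by (auto simp: immersed_curve_def)
  moreover have "c ` {0..1} \<subseteq> S2"
    using imm ran unfolding immersed_curve_def c_def by blast
  moreover have "\<not> collinear {0, velocity c s, velocity c t}" if "(s, t) \<in> double_points c" for s t
    using gen dp[OF that] ab[OF that] pos[of s] pos[of t]
    by (simp add: generic_immersion_def vel collinear_scaleR_iff)
  moreover have "t = u" if "(s, t) \<in> double_points c" "(s, u) \<in> double_points c" for s t u
  proof -
    have "\<phi> t = \<phi> u"
      using gen dp[OF that(1)] dp[OF that(2)] unfolding generic_immersion_def by blast
    then show ?thesis
      using inj ab that by (meson inj_onD)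
  qed
  ultimately have "generic_immersion c"
    unfolding generic_immersion_def immersed_curve_def by blast
  moreover have "(0, t) \<notin> double_points c" for t
    using dp[of 0 t] \<open>\<phi> 0 = 0\<close> assms(1) by (auto simp: proper_curve_def)
  moreover have "(1, t) \<notin> double_points c" for t
  proof
    assume "(1, t) \<in> double_points c"
    then have "t \<in> {0..1}" "t \<noteq> 1" "\<gamma> (\<phi> t) = \<gamma> (\<phi> 1)"
      by (auto simp: double_points_def c_def)
    moreover from this have "\<phi> t \<in> {0..<\<phi> 1}"
      using less[of t 1] ran[of t] by auto
    ultimately show False
      using head by (auto simp: free_head_def)
  qed
  moreover have "c 0 \<noteq> c 1"
    using head \<open>\<phi> 0 = 0\<close> by (auto simp: c_def free_head_def)
  ultimately show ?thesis
    unfolding proper_curve_def c_def by blast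
qed

lemma proper_curve_initial_part:
  assumes "proper_curve \<gamma>" "free_head \<gamma> x"
  shows "proper_curve (\<lambda>t. \<gamma> (x * t))"
proof (rule proper_curve_compose[where \<phi>' = "\<lambda>_. x"])
  show "strict_mono_on {0..1} ((*) x)"
    using assms(2) by (auto simp: strict_mono_on_def free_head_def)
qed (use assms in \<open>auto intro!: smooth01_linear derivative_eq_intros simp: free_head_def\<close>)

text \<open>Restores the linear parametrisation after an isotopy. \<open>\<psi>\<close> is merely
  increasing and onto; smoothness of the result comes from \<open>\<gamma>\<close>. That
  \<open>x\<close> is free is a conclusion: \<open>h\<close> is injective, so an earlier passage of
  \<open>\<gamma>\<close> through the new head would be a crossing at the head of
  \<open>d\<close>.\<close>

lemma isotopic_initial_part:
  assumes \<gamma>: "proper_curve \<gamma>" and d: "knotoid_diagram d"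
    and h: "homotopic_with_canon (\<lambda>f. \<exists>g. homeomorphism S2 S2 f g) S2 S2 id h"
    and mono: "strict_mono_on {0..1} \<psi>" and im: "\<psi> ` {0..1} = {0..x}" and "0 < x" "x \<le> 1"
    and eq: "\<And>t. t \<in> {0..1} \<Longrightarrow> h (curve d t) = \<gamma> (\<psi> t)"
  obtains \<omega> where "free_head \<gamma> x" "knotoid_diagram (initial_part \<gamma> x \<omega>)"
    "plus_welded_move d (initial_part \<gamma> x \<omega>)"
proof -
  obtain k where k: "homeomorphism S2 S2 h k"
    using homotopic_with_imp_property[OF h] by blast
  have inj: "inj_on \<psi> {0..1}"
    using mono strict_mono_on_imp_inj_on by blast
  have less: "\<psi> s < \<psi> t" if "0 \<le> s" "s < t" "t \<le> 1" for s t
    using mono that by (auto simp: strict_mono_on_def)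
  have \<psi>1: "\<psi> 1 = x"
  proof -
    obtain u where u: "u \<in> {0..1}" "\<psi> u = x"
      using im \<open>0 < x\<close> by (metis atLeastAtMost_iff image_iff less_eq_real_def order_refl)
    have "\<psi> 1 \<le> x" using im by auto
    with u less[of u 1] show ?thesis by (cases "u = 1") auto
  qed
  have proper: "proper_curve (curve d)"
    using d knotoid_diagram_iff by blast
  have S2: "curve d t \<in> S2" if "t \<in> {0..1}" for t
    using proper that unfolding proper_curve_def generic_immersion_def immersed_curve_def by blast
  have hinj: "p = q" if "p \<in> S2" "q \<in> S2" "h p = h q" for p q
    using k that homeomorphism_apply1 by metis
  have free: "free_head \<gamma> x"
    unfolding free_head_def
  proof (intro conjI ballI notI)
    fix s assume s: "s \<in> {0..<x}" "\<gamma> s = \<gamma> x"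
    then obtain r where r: "r \<in> {0..1}" "\<psi> r = s"
      using im by (metis atLeastAtMost_iff atLeastLessThan_iff image_iff less_eq_real_def)
    have "r \<noteq> 1" using r s \<psi>1 by auto
    have "h (curve d r) = h (curve d 1)"
      using eq[OF r(1)] eq[of 1] r s \<psi>1 by auto
    then have "curve d 1 = curve d r"
      using hinj S2 r(1) by fastforce
    then have "(1, r) \<in> double_points (curve d)"
      using r \<open>r \<noteq> 1\<close> by (auto simp: double_points_def)
    then show False using proper by (auto simp: proper_curve_def)
  qed fact+
  \<comment> \<open>The change of parameter demanded by \<open>isotopic\<close>: it undoes
    \<open>\<psi>\<close> against the linear parametrisation of \<open>{0..x}\<close>.\<close>
  define \<rho> where "\<rho> = (\<lambda>t. the_inv_into {0..1} \<psi> (x * t))"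
  have xt: "x * t \<in> \<psi> ` {0..1}" if "t \<in> {0..1}" for t
    using im that \<open>0 < x\<close> by (auto simp: mult_left_le)
  have \<rho>: "\<rho> t \<in> {0..1}" "\<psi> (\<rho> t) = x * t" if "t \<in> {0..1}" for t
    using the_inv_into_into[OF inj xt[OF that] order_refl] f_the_inv_into_f[OF inj xt[OF that]]
    by (auto simp: \<rho>_def)
  have "strict_mono_on {0..1} \<rho>"
  proof (rule strict_mono_onI)
    fix s t :: real assume st: "s \<in> {0..1}" "t \<in> {0..1}" "s < t"
    show "\<rho> s < \<rho> t"
    proof (rule ccontr)
      assume "\<not> \<rho> s < \<rho> t"
      then have "\<psi> (\<rho> t) \<le> \<psi> (\<rho> s)"
        using less[of "\<rho> t" "\<rho> s"] \<rho>(1) st by (cases "\<rho> t = \<rho> s") auto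
      then show False using \<rho>(2) st \<open>0 < x\<close> by simp
    qed
  qed
  moreover have "\<rho> ` {0..1} = {0..1}"
  proof
    show "\<rho> ` {0..1} \<subseteq> {0..1}" using \<rho> by blast
    show "{0..1} \<subseteq> \<rho> ` {0..1}"
    proof
      fix r :: real assume r: "r \<in> {0..1}"
      then have "\<psi> r \<in> {0..x}" using im by blast
      then have "\<psi> r / x \<in> {0..1}" using \<open>0 < x\<close> by auto
      moreover from this have "\<rho> (\<psi> r / x) = r"
        using \<rho>[of "\<psi> r / x"] \<open>0 < x\<close> inj r by (auto simp: inj_on_def)
      ultimately show "r \<in> \<rho> ` {0..1}" by force
    qed
  qed
  moreover have e: "\<gamma> (x * t) = h (curve d (\<rho> t))" if "t \<in> {0..1}" for t
    using eq[OF \<rho>(1)[OF that]] \<rho>(2)[OF that] by simp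
  moreover define \<omega> where "\<omega> = {(s, t). s \<in> {0..1} \<and> t \<in> {0..1} \<and> (\<rho> s, \<rho> t) \<in> over d}"
  ultimately have "isotopic d (initial_part \<gamma> x \<omega>)"
    using h unfolding isotopic_def by (intro exI[of _ h] exI[of _ \<rho>]) simp
  moreover have "knotoid_diagram (initial_part \<gamma> x \<omega>)"
    unfolding knotoid_diagram_iff
  proof (intro conjI allI impI)
    show "proper_curve (curve (initial_part \<gamma> x \<omega>))"
      using proper_curve_initial_part[OF \<gamma> free] by simp
    show "over (initial_part \<gamma> x \<omega>) \<subseteq> double_points (curve (initial_part \<gamma> x \<omega>))"
    proof (clarsimp simp: \<omega>_def)
      fix s t :: real assume st: "0 \<le> s" "s \<le> 1" "0 \<le> t" "t \<le> 1" "(\<rho> s, \<rho> t) \<in> over d"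
      then have "(\<rho> s, \<rho> t) \<in> double_points (curve d)"
        using d knotoid_diagram_iff by blast
      then show "(s, t) \<in> double_points (\<lambda>t. \<gamma> (x * t))"
        using e[of s] e[of t] st by (auto simp: double_points_def)
    qed
    show "(t, s) \<notin> over (initial_part \<gamma> x \<omega>)" if "(s, t) \<in> over (initial_part \<gamma> x \<omega>)" for s t
      using that d by (auto simp: \<omega>_def knotoid_diagram_iff)
  qed
  ultimately show ?thesis
    using that free d unfolding plus_welded_move_def by blast
qed

section \<open>Spherical caps\<close>

text \<open>The point \<open>p\<close> is the pole of a hemisphere, charted by the coordinates along
  the tangent vectors \<open>a\<close> and \<open>b\<close>. In both applications \<open>a\<close>
  is the unit tangent of the curve at \<open>p\<close>.\<close>

locale frame =
  fixes p a b :: "real^3"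
  assumes unit: "p \<bullet> p = 1" "a \<bullet> a = 1" "b \<bullet> b = 1"
    and orth: "a \<bullet> p = 0" "b \<bullet> p = 0" "a \<bullet> b = 0"
begin

lemma orth': "p \<bullet> a = 0" "p \<bullet> b = 0" "b \<bullet> a = 0"
  using orth by (simp_all add: inner_commute)

lemma expand: "q = (q \<bullet> a) *\<^sub>R a + (q \<bullet> b) *\<^sub>R b + (q \<bullet> p) *\<^sub>R p"
proof -
  have distinct: "a \<noteq> b" "a \<noteq> p" "b \<noteq> p"
    using unit orth by auto
  have po: "pairwise orthogonal {a, b, p}"
    using orth orth' by (auto simp: pairwise_def orthogonal_def)
  have "independent {a, b, p}"
    by (rule pairwise_orthogonal_independent[OF po]) (use unit in auto)
  moreover have "card {a, b, p} = DIM(real^3)"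
    using distinct by simp
  ultimately have "span {a, b, p} = UNIV"
    using card_ge_dim_independent[of "{a, b, p}" UNIV] by auto
  then have "(\<Sum>v\<in>{a, b, p}. (q \<bullet> v) *\<^sub>R v) = q"
    using unit by (intro orthonormal_basis_expand[OF po]) (auto simp: norm_eq_1)
  then show ?thesis
    using distinct by (simp add: add.assoc)
qed

lemma frame_eqI:
  assumes "q \<bullet> a = r \<bullet> a" "q \<bullet> b = r \<bullet> b" "q \<bullet> p = r \<bullet> p"
  shows "q = r"
  using expand[of q] expand[of r] assms by simp

lemma frame_coordinates:
  "(u *\<^sub>R a + w *\<^sub>R b + h *\<^sub>R p) \<bullet> a = u"
  "(u *\<^sub>R a + w *\<^sub>R b + h *\<^sub>R p) \<bullet> b = w"
  "(u *\<^sub>R a + w *\<^sub>R b + h *\<^sub>R p) \<bullet> p = h"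
  by (simp_all add: inner_add_left unit orth orth')

lemma inner_self_eq: "q \<bullet> q = (q \<bullet> a)\<^sup>2 + (q \<bullet> b)\<^sup>2 + (q \<bullet> p)\<^sup>2"
  by (subst (2) expand, simp add: inner_add_right power2_eq_square)

lemma S2_iff: "q \<in> S2 \<longleftrightarrow> (q \<bullet> a)\<^sup>2 + (q \<bullet> b)\<^sup>2 + (q \<bullet> p)\<^sup>2 = 1"
  by (simp add: norm_eq_1 flip: inner_self_eq)

lemma p_in_S2: "p \<in> S2"
  by (simp add: norm_eq_1 unit)

lemma S2_eqI:
  assumes "q \<in> S2" "r \<in> S2" "q \<bullet> a = r \<bullet> a" "q \<bullet> b = r \<bullet> b" "0 \<le> q \<bullet> p" "0 \<le> r \<bullet> p"
  shows "q = r"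
proof (rule frame_eqI)
  have "(q \<bullet> p)\<^sup>2 = (r \<bullet> p)\<^sup>2"
    using assms(1-4) unfolding S2_iff by simp
  then show "q \<bullet> p = r \<bullet> p"
    using assms(5,6) by simp
qed fact+

text \<open>On the closed unit disc, the inverse of the orthogonal projection of the hemisphere
  \<open>0 \<le> q \<bullet> p\<close> to the plane of \<open>a\<close> and
  \<open>b\<close>.\<close>

definition lift :: "real \<Rightarrow> real \<Rightarrow> real^3" where
  "lift u w = u *\<^sub>R a + w *\<^sub>R b + sqrt (1 - (u\<^sup>2 + w\<^sup>2)) *\<^sub>R p"

lemma lift_coordinates [simp]:
  "lift u w \<bullet> a = u" "lift u w \<bullet> b = w" "lift u w \<bullet> p = sqrt (1 - (u\<^sup>2 + w\<^sup>2))"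
  by (simp_all add: lift_def frame_coordinates)

lemma lift_in_S2: "u\<^sup>2 + w\<^sup>2 \<le> 1 \<Longrightarrow> lift u w \<in> S2"
  unfolding S2_iff by simp

lemma lift_eq: "q \<in> S2 \<Longrightarrow> 0 \<le> q \<bullet> p \<Longrightarrow> lift (q \<bullet> a) (q \<bullet> b) = q"
proof -
  assume q: "q \<in> S2" "0 \<le> q \<bullet> p"
  then have "(q \<bullet> a)\<^sup>2 + (q \<bullet> b)\<^sup>2 \<le> 1"
    by (smt (verit) S2_iff zero_le_power2)
  then show ?thesis
    using q by (intro S2_eqI lift_in_S2) auto
qed

text \<open>The projection along \<open>p\<close> sends the cap onto a disc of radius
  \<open>sqrt (1 - \<kappa>\<^sup>2)\<close>, the rim onto its boundary circle; as
  \<open>\<kappa>\<close> is positive, \<open>lift\<close> inverts it. The maps \<open>f\<close> and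
  \<open>g\<close> include the scaling by this radius.\<close>

lemma disc_cap:
  assumes \<kappa>: "0 < \<kappa>" "\<kappa> < 1"
  shows "disc_with_boundary {q \<in> S2. \<kappa> \<le> q \<bullet> p} {q \<in> S2. q \<bullet> p = \<kappa>}"
proof -
  define R where "R = sqrt (1 - \<kappa>\<^sup>2)"
  have k1: "\<kappa>\<^sup>2 < 1" using \<kappa> by (simp add: power_less_one_iff abs_square_less_1)
  have R: "0 < R" "R\<^sup>2 = 1 - \<kappa>\<^sup>2"
    using k1 by (auto simp: R_def)
  define f where "f = (\<lambda>z::real^2. lift (R * z$1) (R * z$2))"
  define g where "g = (\<lambda>q. vector [q \<bullet> a / R, q \<bullet> b / R] :: real^2)"
  have n2: "(norm z)\<^sup>2 = (z$1)\<^sup>2 + (z$2)\<^sup>2" for z :: "real^2"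
    by (simp add: norm_vec_def L2_set_def sum_2)
  have sq: "(R * x)\<^sup>2 + (R * y)\<^sup>2 = R\<^sup>2 * (x\<^sup>2 + y\<^sup>2)" for x y
    by (simp add: power_mult_distrib algebra_simps)
  have f: "f z \<in> S2" "\<kappa> \<le> f z \<bullet> p" "norm z = 1 \<Longrightarrow> f z \<bullet> p = \<kappa>" if "norm z \<le> 1" for z
  proof -
    have "(norm z)\<^sup>2 \<le> 1" using that by (simp add: power_le_one)
    then have le: "R\<^sup>2 * (norm z)\<^sup>2 \<le> R\<^sup>2"
      by (simp add: mult_left_le)
    then have "(R * z$1)\<^sup>2 + (R * z$2)\<^sup>2 \<le> 1 - \<kappa>\<^sup>2"
      using R by (simp add: sq n2)
    then have "(R * z$1)\<^sup>2 + (R * z$2)\<^sup>2 \<le> 1" "\<kappa>\<^sup>2 \<le> 1 - ((R * z$1)\<^sup>2 + (R * z$2)\<^sup>2)"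
      using zero_le_power2[of \<kappa>] by linarith+
    then show "\<kappa> \<le> f z \<bullet> p"
      by (simp add: f_def real_le_rsqrt)
    show "f z \<in> S2"
      unfolding f_def by (rule lift_in_S2) fact
    show "f z \<bullet> p = \<kappa>" if "norm z = 1"
      using n2[of z] that \<kappa> R by (simp add: f_def sq)
  qed
  have gf: "g (f z) = z" for z
    using R by (simp add: g_def f_def vec_eq_iff forall_2)
  have g: "norm (g q) \<le> 1" "q \<bullet> p = \<kappa> \<Longrightarrow> norm (g q) = 1" "f (g q) = q"
    if q: "q \<in> S2" "\<kappa> \<le> q \<bullet> p" for q
  proof -
    have "(norm (g q))\<^sup>2 = ((q \<bullet> a)\<^sup>2 + (q \<bullet> b)\<^sup>2) / R\<^sup>2"
      by (simp add: n2 g_def power_divide add_divide_distrib)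
    also have "(q \<bullet> a)\<^sup>2 + (q \<bullet> b)\<^sup>2 = 1 - (q \<bullet> p)\<^sup>2"
      using q(1) unfolding S2_iff by linarith
    finally have eq: "(norm (g q))\<^sup>2 = (1 - (q \<bullet> p)\<^sup>2) / (1 - \<kappa>\<^sup>2)" by (simp add: R)
    have "\<kappa>\<^sup>2 \<le> (q \<bullet> p)\<^sup>2"
      using q(2) \<kappa> by (intro power_mono) auto
    then have "(norm (g q))\<^sup>2 \<le> 1"
      unfolding eq using k1 by simp
    then show "norm (g q) \<le> 1" by (simp add: abs_square_le_1)
    show "norm (g q) = 1" if "q \<bullet> p = \<kappa>"
    proof -
      have "(norm (g q))\<^sup>2 = 1\<^sup>2" unfolding eq that using k1 by simp
      then show ?thesis
        using norm_ge_zero[of "g q"] unfolding power2_eq_iff by linarith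
    qed
    show "f (g q) = q"
      using R q \<kappa> lift_eq[of q] by (simp add: f_def g_def)
  qed
  have cf: "continuous_on UNIV f"
    unfolding f_def lift_def by (intro continuous_intros)
  have "continuous_on UNIV (\<lambda>q. g q $ i)" for i
  proof -
    consider "i = 1" | "i = 2" using exhaust_2 by blast
    then show ?thesis
      by cases (use R in \<open>auto simp: g_def intro!: continuous_intros\<close>)
  qed
  then have "continuous_on UNIV (\<lambda>q. \<chi> i. g q $ i)"
    by (rule continuous_on_vec_lambda)
  then have cg: "continuous_on UNIV g"
    by simp
  let ?B = "{q \<in> S2. \<kappa> \<le> q \<bullet> p}" and ?K = "{q \<in> S2. q \<bullet> p = \<kappa>}"
  have "homeomorphism (cball 0 1) ?B f g"
    unfolding homeomorphism_def
  proof (intro conjI ballI)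
    show "f ` cball 0 1 = ?B"
    proof
      show "?B \<subseteq> f ` cball 0 1"
        by (rule subsetI, rule image_eqI[of _ f "g q" for q]) (use g in auto)
    qed (use f in auto)
    show "g ` ?B = cball 0 1"
    proof
      show "cball 0 1 \<subseteq> g ` ?B"
        by (rule subsetI, rule image_eqI[of _ g "f z" for z]) (use f gf in auto)
    qed (use g in auto)
  qed (use gf g in \<open>auto intro: continuous_on_subset[OF cf] continuous_on_subset[OF cg]\<close>)
  moreover have "?K = f ` sphere 0 1"
  proof
    show "?K \<subseteq> f ` sphere 0 1"
      by (rule subsetI, rule image_eqI[of _ f "g q" for q]) (use g in auto)
  qed (use f in auto)
  ultimately show ?thesis
    unfolding disc_with_boundary_def by blast
qed

end

lemma frame_exists:
  assumes "p \<in> S2" "v \<bullet> p = 0" "v \<noteq> 0"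
  obtains b where "frame p (v /\<^sub>R norm v) b"
proof
  let ?a = "v /\<^sub>R norm v"
  have p: "p \<bullet> p = 1" using assms(1) by (simp add: norm_eq_1)
  have a: "?a \<bullet> ?a = 1" "?a \<bullet> p = 0"
    using assms by (auto simp: dot_square_norm power2_eq_square field_simps)
  have "cross3 p ?a \<bullet> cross3 p ?a = 1"
    using norm_cross[of p ?a] a p by (simp add: dot_square_norm inner_commute)
  then show "frame p ?a (cross3 p ?a)"
    using a p by unfold_locales (auto simp: dot_cross_self)
qed

section \<open>A push along an arc\<close>

text \<open>The graph of \<open>f\<close> is the projected arc, \<open>\<epsilon>\<close> the size
  of the support of the push and \<open>\<delta>\<close> its largest displacement. The assumption
  \<open>small\<close> keeps the support inside the open unit disc, so that the push extends by the
  identity over the other hemisphere.\<close>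

locale graph_push = frame +
  fixes f :: "real \<Rightarrow> real" and \<epsilon> \<delta> :: real
  assumes cont: "continuous_on UNIV f" and \<epsilon>: "0 < \<delta>" "\<delta> < \<epsilon>"
    and small: "\<bar>u\<bar> + \<bar>w - f u\<bar> < \<epsilon> \<Longrightarrow> u\<^sup>2 + w\<^sup>2 < 1"
begin

text \<open>A tent of slope \<open>1 / \<epsilon>\<close> and height \<open>k\<close> is subtracted;
  a tent is enough because \<open>isotopic\<close> asks for homeomorphisms. The parameter
  \<open>v\<close> is the height above the graph.\<close>

definition shift :: "real \<Rightarrow> real \<Rightarrow> real \<Rightarrow> real" where
  "shift k v u = u - k * max 0 (1 - (\<bar>u\<bar> + \<bar>v\<bar>) / \<epsilon>)"

lemma shift_less:
  assumes "0 \<le> k" "k \<le> \<delta>" "u < u'"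
  shows "shift k v u < shift k v u'"
proof -
  define m where "m = (\<lambda>u. max 0 (1 - (\<bar>u\<bar> + \<bar>v\<bar>) / \<epsilon>))"
  have "m u' - m u \<le> (\<bar>u\<bar> + \<bar>v\<bar>) / \<epsilon> - (\<bar>u'\<bar> + \<bar>v\<bar>) / \<epsilon> \<or> m u' \<le> m u"
    unfolding m_def by linarith
  moreover have "(\<bar>u\<bar> + \<bar>v\<bar>) / \<epsilon> - (\<bar>u'\<bar> + \<bar>v\<bar>) / \<epsilon> \<le> (u' - u) / \<epsilon>"
    using \<epsilon> assms(3) unfolding diff_divide_distrib[symmetric] by (intro divide_right_mono) auto
  moreover have "0 < (u' - u) / \<epsilon>"
    using assms \<epsilon> by simp
  ultimately have "m u' - m u \<le> (u' - u) / \<epsilon>" by linarith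
  then have "k * (m u' - m u) \<le> k * ((u' - u) / \<epsilon>)"
    using assms(1) by (rule mult_left_mono)
  also have "\<dots> = (k / \<epsilon>) * (u' - u)" by simp
  also have "\<dots> < 1 * (u' - u)"
    using assms \<epsilon> by (intro mult_strict_right_mono) auto
  finally show ?thesis
    by (simp add: shift_def m_def algebra_simps)
qed

lemma shift_le: "0 \<le> k \<Longrightarrow> shift k v u \<le> u"
  by (simp add: shift_def)

lemma shift_id: "\<epsilon> \<le> \<bar>u\<bar> + \<bar>v\<bar> \<Longrightarrow> shift k v u = u"
  using \<epsilon> by (simp add: shift_def field_simps)

lemma shift_surj:
  assumes "0 \<le> k"
  shows "\<exists>u. shift k v u = y"
proof -
  \<comment> \<open>No displacement exceeds \<open>k\<close>, so \<open>y\<close> lies between the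
    values at \<open>y\<close> and at \<open>y + k\<close>.\<close>
  have "max 0 (1 - (\<bar>y + k\<bar> + \<bar>v\<bar>) / \<epsilon>) \<le> 1"
    using \<epsilon> by simp
  then have "y \<le> shift k v (y + k)"
    using assms mult_left_le[of "max 0 (1 - (\<bar>y + k\<bar> + \<bar>v\<bar>) / \<epsilon>)" k] unfolding shift_def by linarith
  moreover have "continuous_on {y..y + k} (shift k v)"
    unfolding shift_def using \<epsilon> by (intro continuous_intros) auto
  ultimately show ?thesis
    using IVT'[of "shift k v" y y "y + k"] shift_le[OF assms] assms by auto
qed

text \<open>
  In the coordinates \<open>(u, w - f u)\<close>, which straighten the graph of \<open>f\<close>, the map moves points
  horizontally by the bump function in \<open>shift\<close>; its Lipschitz constant \<open>k / \<epsilon> < 1\<close> keeps the map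
  injective.
\<close>

definition px :: "real \<Rightarrow> real \<Rightarrow> real \<Rightarrow> real" where
  "px k u w = shift k (w - f u) u"

definition py :: "real \<Rightarrow> real \<Rightarrow> real \<Rightarrow> real" where
  "py k u w = w - f u + f (px k u w)"

lemma p_inj:
  assumes "0 \<le> k" "k \<le> \<delta>" "px k u w = px k u' w'" "py k u w = py k u' w'"
  shows "u = u' \<and> w = w'"
proof -
  have v: "w - f u = w' - f u'" using assms(3,4) by (simp add: py_def)
  have "u = u'"
    using assms(3) shift_less[OF assms(1,2), of u u'] shift_less[OF assms(1,2), of u' u]
    unfolding px_def v by (metis less_irrefl linorder_neqE_linordered_idom)
  with v show ?thesis by simp
qed

lemma p_id: "\<epsilon> \<le> \<bar>u\<bar> + \<bar>w - f u\<bar> \<Longrightarrow> px k u w = u \<and> py k u w = w"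
  by (simp add: px_def py_def shift_id)

lemma p_id_outside: "1 \<le> u\<^sup>2 + w\<^sup>2 \<Longrightarrow> px k u w = u \<and> py k u w = w"
  using p_id small[of u w] by force

lemma p_surj:
  assumes "0 \<le> k"
  obtains u w where "px k u w = x" "py k u w = y"
proof -
  obtain u where u: "shift k (y - f x) u = x"
    using shift_surj[OF assms] by blast
  show ?thesis
    by (rule that[of u "y - f x + f u"]) (simp_all add: px_def py_def u)
qed

text \<open>Points outside the open disc are fixed. An image outside the disc would be a fixed
  point, hence by injectivity equal to the point it came from, which lies inside.\<close>

lemma p_disc:
  assumes "0 \<le> k" "k \<le> \<delta>" "u\<^sup>2 + w\<^sup>2 \<le> 1"
  shows "(px k u w)\<^sup>2 + (py k u w)\<^sup>2 \<le> 1"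
proof (rule ccontr)
  assume *: "\<not> ?thesis"
  then have "px k (px k u w) (py k u w) = px k u w \<and> py k (px k u w) (py k u w) = py k u w"
    by (intro p_id_outside) simp
  then have "px k u w = u \<and> py k u w = w"
    using p_inj[OF assms(1,2)] by blast
  then show False using * assms(3) by simp
qed

text \<open>The planar push carried to the upper hemisphere by the projection. On the equator the
  projected point has norm 1, where the push is the identity, so the two branches fit
  together.\<close>

definition flow :: "real \<Rightarrow> real^3 \<Rightarrow> real^3" where
  "flow k q = (if 0 \<le> q \<bullet> p then lift (px k (q \<bullet> a) (q \<bullet> b)) (py k (q \<bullet> a) (q \<bullet> b)) else q)"

lemma S2_disc: "q \<in> S2 \<Longrightarrow> (q \<bullet> a)\<^sup>2 + (q \<bullet> b)\<^sup>2 \<le> 1"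
  by (smt (verit) S2_iff zero_le_power2)

lemma flow_in_S2:
  assumes "0 \<le> k" "k \<le> \<delta>" "q \<in> S2"
  shows "flow k q \<in> S2"
proof (cases "0 \<le> q \<bullet> p")
  case True
  then show ?thesis
    using lift_in_S2[OF p_disc[OF assms(1,2) S2_disc[OF assms(3)]]] by (simp only: flow_def if_True)
qed (use assms in \<open>simp add: flow_def\<close>)

lemma flow_coordinates:
  assumes "0 \<le> q \<bullet> p"
  shows "flow k q \<bullet> a = px k (q \<bullet> a) (q \<bullet> b)" "flow k q \<bullet> b = py k (q \<bullet> a) (q \<bullet> b)"
  using assms by (simp_all add: flow_def)

lemma flow_height:
  assumes "0 \<le> k" "k \<le> \<delta>" "q \<in> S2"
  shows "0 \<le> flow k q \<bullet> p \<longleftrightarrow> 0 \<le> q \<bullet> p"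
  using p_disc[OF assms(1,2) S2_disc[OF assms(3)]] by (simp add: flow_def)

lemma flow_id:
  assumes "q \<in> S2" "0 \<le> q \<bullet> p \<Longrightarrow> \<epsilon> \<le> \<bar>q \<bullet> a\<bar> + \<bar>q \<bullet> b - f (q \<bullet> a)\<bar>"
  shows "flow k q = q"
  using assms p_id lift_eq by (auto simp: flow_def)

lemma flow_0: "q \<in> S2 \<Longrightarrow> flow 0 q = q"
  using lift_eq by (simp add: flow_def px_def py_def shift_def)

lemma flow_inj:
  assumes "0 \<le> k" "k \<le> \<delta>"
  shows "inj_on (flow k) S2"
proof (rule inj_onI)
  fix q r assume q: "q \<in> S2" and r: "r \<in> S2" and eq: "flow k q = flow k r"
  then have iff: "0 \<le> q \<bullet> p \<longleftrightarrow> 0 \<le> r \<bullet> p"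
    using flow_height[OF assms] by metis
  show "q = r"
  proof (cases "0 \<le> q \<bullet> p")
    case True
    then have "q \<bullet> a = r \<bullet> a \<and> q \<bullet> b = r \<bullet> b"
      using eq iff by (intro p_inj[OF assms]) (metis flow_coordinates)+
    then show ?thesis
      using q r True iff by (intro S2_eqI) auto
  qed (use eq iff in \<open>simp add: flow_def\<close>)
qed

lemma flow_surj:
  assumes "0 \<le> k" "k \<le> \<delta>"
  shows "flow k ` S2 = S2"
proof
  show "flow k ` S2 \<subseteq> S2" using flow_in_S2[OF assms] by blast
  show "S2 \<subseteq> flow k ` S2"
  proof
    fix r assume r: "r \<in> S2"
    show "r \<in> flow k ` S2"
    proof (cases "0 \<le> r \<bullet> p")
      case True
      obtain u w where uw: "px k u w = r \<bullet> a" "py k u w = r \<bullet> b"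
        using p_surj[OF assms(1)] by blast
      \<comment> \<open>A preimage outside the disc would be fixed, putting the projection of
        \<open>r\<close> outside the disc too.\<close>
      have disc: "u\<^sup>2 + w\<^sup>2 \<le> 1"
      proof (rule ccontr)
        assume "\<not> ?thesis"
        with p_id_outside[of u w k] uw S2_disc[OF r] show False by simp
      qed
      have "flow k (lift u w) = r"
      proof (rule S2_eqI)
        show "flow k (lift u w) \<in> S2"
          by (rule flow_in_S2[OF assms lift_in_S2[OF disc]])
        show "0 \<le> flow k (lift u w) \<bullet> p"
          unfolding flow_height[OF assms lift_in_S2[OF disc]] using disc by simp
      qed (use r True uw disc flow_coordinates[of "lift u w" k] in auto)
      with lift_in_S2[OF disc] show ?thesis by (metis image_eqI)
    next
      case False
      then have "flow k r = r" by (simp add: flow_def)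
      with r show ?thesis by (metis image_eqI)
    qed
  qed
qed

text \<open>Pasting over the two closed hemispheres, jointly in \<open>k\<close> and
  \<open>q\<close>, because \<open>k\<close> becomes the time of the isotopy.\<close>

lemma flow_continuous: "continuous_on ({0..\<delta>} \<times> S2) (\<lambda>(k, q). flow k q)"
proof -
  let ?X = "{0..\<delta>} \<times> S2"
  let ?U = "?X \<inter> {x. 0 \<le> snd x \<bullet> p}" and ?L = "?X \<inter> {x. snd x \<bullet> p \<le> 0}"
  have "continuous_on (?U \<union> ?L)
     (\<lambda>x. if 0 \<le> snd x \<bullet> p then lift (px (fst x) (snd x \<bullet> a) (snd x \<bullet> b)) (py (fst x) (snd x \<bullet> a) (snd x \<bullet> b))
          else snd x)"
  proof (rule continuous_on_cases)
    have X: "closed ?X" by (intro closed_Times) auto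
    show "closed ?U" "closed ?L"
      by (intro closed_Int X closed_Collect_le continuous_intros)+
    show "continuous_on ?U (\<lambda>x. lift (px (fst x) (snd x \<bullet> a) (snd x \<bullet> b)) (py (fst x) (snd x \<bullet> a) (snd x \<bullet> b)))"
      unfolding lift_def py_def px_def shift_def
      using \<epsilon> by (intro continuous_intros continuous_on_compose2[OF cont]) auto
    show "\<forall>x. x \<in> ?U \<and> \<not> 0 \<le> snd x \<bullet> p \<or> x \<in> ?L \<and> 0 \<le> snd x \<bullet> p \<longrightarrow>
       lift (px (fst x) (snd x \<bullet> a) (snd x \<bullet> b)) (py (fst x) (snd x \<bullet> a) (snd x \<bullet> b)) = snd x"
    proof (intro allI impI)
      fix x assume "x \<in> ?U \<and> \<not> 0 \<le> snd x \<bullet> p \<or> x \<in> ?L \<and> 0 \<le> snd x \<bullet> p"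
      then have x: "snd x \<in> S2" "snd x \<bullet> p = 0" by auto
      then have "(snd x \<bullet> a)\<^sup>2 + (snd x \<bullet> b)\<^sup>2 = 1"
        unfolding S2_iff by simp
      then have "px (fst x) (snd x \<bullet> a) (snd x \<bullet> b) = snd x \<bullet> a \<and> py (fst x) (snd x \<bullet> a) (snd x \<bullet> b) = snd x \<bullet> b"
        by (intro p_id_outside) simp
      then show "lift (px (fst x) (snd x \<bullet> a) (snd x \<bullet> b)) (py (fst x) (snd x \<bullet> a) (snd x \<bullet> b)) = snd x"
        using lift_eq[OF x(1)] x(2) by simp
    qed
  qed (intro continuous_intros)
  moreover have "?U \<union> ?L = ?X" by (auto simp: linear)
  ultimately show ?thesis
    by (simp add: flow_def case_prod_unfold)
qed

lemma flow_isotopy: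
  "homotopic_with_canon (\<lambda>f. \<exists>g. homeomorphism S2 S2 f g) S2 S2 id (flow \<delta>)"
proof -
  have homeo: "\<exists>g. homeomorphism S2 S2 (flow k) g" if "k \<in> {0..\<delta>}" for k
  proof -
    have "continuous_on S2 (\<lambda>q. (\<lambda>(k, q). flow k q) (k, q))"
      by (rule continuous_on_compose2[OF flow_continuous]) (use that in \<open>auto intro!: continuous_intros\<close>)
    then show ?thesis
      using that by (intro homeomorphism_compact flow_surj flow_inj) auto
  qed
  \<comment> \<open>Time 0 is treated separately because \<open>homotopic_with\<close> wants the
    identity at every point of the ambient space, whereas \<open>flow 0\<close> is the identity only
    on the sphere.\<close>
  define H where "H = (\<lambda>(s::real, q). if s = 0 then q else flow (s * \<delta>) q)"
  have H: "H (s, q) = flow (s * \<delta>) q" if "q \<in> S2" for s q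
    using flow_0[OF that] by (simp add: H_def)
  have sd: "s * \<delta> \<in> {0..\<delta>}" if "s \<in> {0..1}" for s
    using that \<epsilon> by (auto simp: mult_left_le_one_le)
  have "continuous_on ({0..1} \<times> S2) (\<lambda>x. (\<lambda>(k, q). flow k q) (fst x * \<delta>, snd x))"
    by (rule continuous_on_compose2[OF flow_continuous]) (use sd in \<open>auto intro!: continuous_intros\<close>)
  then have cH: "continuous_on ({0..1} \<times> S2) H"
    by (rule continuous_on_eq) (auto simp: H)
  have "H \<in> {0..1} \<times> S2 \<rightarrow> S2"
    using flow_in_S2 sd H by fastforce
  with cH have "continuous_map (prod_topology (top_of_set {0..1}) (top_of_set S2)) (top_of_set S2) H"
    by (simp add: prod_topology_subtopology_eu continuous_map_subtopology_eu)
  moreover have "\<exists>g. homeomorphism S2 S2 (\<lambda>q. H (t, q)) g" if t: "t \<in> {0..1}" for t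
  proof -
    obtain g where "homeomorphism S2 S2 (flow (t * \<delta>)) g"
      using homeo[OF sd[OF t]] by blast
    then show ?thesis
      using H homeomorphism_cong[of S2 S2 "flow (t * \<delta>)" g] by metis
  qed
  ultimately show ?thesis
    unfolding homotopic_with_def by (intro exI[of _ H]) (auto simp: H_def)
qed

end

section \<open>Retracting the head\<close>

text \<open>Positivity is asked only in the open interval, since the derivative of the height
  vanishes at a peak, which is an end of the intervals considered later.\<close>

lemma increasing_from_derivative:
  fixes g g' :: "real \<Rightarrow> real"
  assumes der: "\<And>t. t \<in> {0..1} \<Longrightarrow> (g has_real_derivative g' t) (at t within {0..1})"
    and pos: "\<And>t. l < t \<Longrightarrow> t < r \<Longrightarrow> 0 < g' t"
    and "0 \<le> l" "r \<le> 1" "l \<le> s" "s < t" "t \<le> r"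
  shows "g s < g t"
proof (rule DERIV_pos_imp_increasing_open[OF \<open>s < t\<close>])
  fix x assume x: "s < x" "x < t"
  then have "at x within {0..1} = at x"
    using assms by (intro at_within_interior) auto
  then show "\<exists>y. (g has_real_derivative y) (at x) \<and> 0 < y"
    using der[of x] pos[of x] x assms by auto
next
  have "continuous_on {0..1} g"
    using der by (intro DERIV_continuous_on)
  then show "continuous_on {s..t} g"
    by (rule continuous_on_subset) (use assms in auto)
qed

lemma proper_curve_velocity:
  assumes "proper_curve \<gamma>"
  shows "t \<in> {0..1} \<Longrightarrow> (\<gamma> has_vector_derivative velocity \<gamma> t) (at t within {0..1})"
    and "continuous_on {0..1} \<gamma>"
    and "t \<in> {0..1} \<Longrightarrow> \<gamma> t \<in> S2"
    and "t \<in> {0..1} \<Longrightarrow> velocity \<gamma> t \<noteq> 0"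
    and "t \<in> {0..1} \<Longrightarrow> velocity \<gamma> t \<bullet> \<gamma> t = 0"
proof -
  let ?I = "{0..1::real}"
  have sm: "smooth_curve \<gamma>" and S2: "\<And>t. t \<in> ?I \<Longrightarrow> \<gamma> t \<in> S2"
    and nz: "\<And>t. t \<in> ?I \<Longrightarrow> velocity \<gamma> t \<noteq> 0"
    using assms unfolding proper_curve_def generic_immersion_def immersed_curve_def by blast+
  show d1: "(\<gamma> has_vector_derivative velocity \<gamma> t) (at t within ?I)" if "t \<in> ?I" for t
    using smooth_curve_velocity[OF sm that] .
  then show "continuous_on ?I \<gamma>"
    by (meson continuous_on_eq_continuous_within has_vector_derivative_continuous)
  have const: "\<gamma> t \<bullet> \<gamma> t = 1" if "t \<in> ?I" for t
    using S2[OF that] by (simp add: norm_eq_1)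
  show "velocity \<gamma> t \<bullet> \<gamma> t = 0" if t: "t \<in> ?I"
  proof -
    have "((\<lambda>s. \<gamma> s \<bullet> \<gamma> s) has_vector_derivative (\<gamma> t \<bullet> velocity \<gamma> t + velocity \<gamma> t \<bullet> \<gamma> t)) (at t within ?I)"
      by (rule bounded_bilinear.has_vector_derivative[OF bounded_bilinear_inner d1[OF t] d1[OF t]])
    moreover have "((\<lambda>s. \<gamma> s \<bullet> \<gamma> s) has_vector_derivative 0) (at t within ?I)"
      by (rule has_vector_derivative_transform[OF t _ has_vector_derivative_const[of 1]]) (use const in simp)
    ultimately have "\<gamma> t \<bullet> velocity \<gamma> t + velocity \<gamma> t \<bullet> \<gamma> t = 0"
      using vector_derivative_unique_within_closed_interval[of 0 1 t] t by simp
    then show ?thesis by (simp add: inner_commute)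
  qed
qed (use assms in \<open>unfold proper_curve_def generic_immersion_def immersed_curve_def, blast+\<close>)

text \<open>Differentiating the orthogonality of velocity and position gives the last equation; it
  makes the height concave near its peak.\<close>

lemma proper_curve_acceleration:
  assumes "proper_curve \<gamma>"
  obtains A where
    "\<And>t. t \<in> {0..1} \<Longrightarrow> (velocity \<gamma> has_vector_derivative A t) (at t within {0..1})"
    "continuous_on {0..1} A"
    "\<And>t. t \<in> {0..1} \<Longrightarrow> A t \<bullet> \<gamma> t = - (velocity \<gamma> t \<bullet> velocity \<gamma> t)"
proof -
  let ?I = "{0..1::real}"
  obtain D where D0: "D 0 = \<gamma>"
    and D: "\<And>n t. t \<in> ?I \<Longrightarrow> (D n has_vector_derivative D (Suc n) t) (at t within ?I)"
    using assms unfolding proper_curve_def generic_immersion_def immersed_curve_def smooth_curve_def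
    by blast
  have v1: "velocity \<gamma> t = D 1 t" if "t \<in> ?I" for t
    using D[OF that, of 0] D0 that by (intro vector_derivative_within_closed_interval) auto
  have d2: "(velocity \<gamma> has_vector_derivative D 2 t) (at t within ?I)" if "t \<in> ?I" for t
    by (rule has_vector_derivative_transform[OF that _ D[OF that, of 1, simplified, folded numeral_2_eq_2]])
       (use v1 in simp)
  have "continuous_on ?I (D 2)"
    using D[of _ 2] by (meson continuous_on_eq_continuous_within has_vector_derivative_continuous)
  moreover have "D 2 t \<bullet> \<gamma> t = - (velocity \<gamma> t \<bullet> velocity \<gamma> t)" if t: "t \<in> ?I" for t
  proof -
    have "((\<lambda>s. velocity \<gamma> s \<bullet> \<gamma> s) has_vector_derivative
        (velocity \<gamma> t \<bullet> velocity \<gamma> t + D 2 t \<bullet> \<gamma> t)) (at t within ?I)"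
      by (rule bounded_bilinear.has_vector_derivative[OF bounded_bilinear_inner d2[OF t]
            proper_curve_velocity(1)[OF assms t]])
    moreover have "((\<lambda>s. velocity \<gamma> s \<bullet> \<gamma> s) has_vector_derivative 0) (at t within ?I)"
      by (rule has_vector_derivative_transform[OF t _ has_vector_derivative_const[of 0]])
         (use proper_curve_velocity(5)[OF assms] in simp)
    ultimately have "velocity \<gamma> t \<bullet> velocity \<gamma> t + D 2 t \<bullet> \<gamma> t = 0"
      using vector_derivative_unique_within_closed_interval[of 0 1 t] t by simp
    then show ?thesis by simp
  qed
  ultimately show ?thesis
    using that[of "D 2"] d2 by simp
qed

lemma inner_has_real_derivative:
  assumes "(\<gamma> has_vector_derivative v) (at t within S)"
  shows "((\<lambda>t. \<gamma> t \<bullet> q) has_real_derivative v \<bullet> q) (at t within S)"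
  using bounded_linear.has_vector_derivative[OF bounded_linear_inner_left assms]
  by (simp add: has_real_derivative_iff_has_vector_derivative)

lemma near_pos:
  fixes g :: "real \<Rightarrow> real"
  assumes "continuous_on {0..1} g" "m \<in> {0..1}" "0 < g m"
  obtains e where "e > 0" "\<And>t. t \<in> {0..1} \<Longrightarrow> \<bar>t - m\<bar> < e \<Longrightarrow> 0 < g t"
proof -
  obtain e where "e > 0" "\<And>t. t \<in> {0..1} \<Longrightarrow> dist t m < e \<Longrightarrow> dist (g t) (g m) < g m"
    using assms unfolding continuous_on_iff by blast
  then show ?thesis
    by (intro that[of e]) (fastforce simp: dist_real_def)+
qed

text \<open>A single push at \<open>m\<close> serves all \<open>y\<close>: it moves the point at
  \<open>m\<close> strictly back along the curve, so by continuity it also takes points slightly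
  beyond \<open>m\<close> to parameters below \<open>m\<close>. The assumption \<open>free\<close>
  keeps the earlier part of the curve away from the support.\<close>

lemma retract_free_head:
  assumes \<gamma>: "proper_curve \<gamma>" and free: "free_head \<gamma> m"
  shows "\<exists>e>0. \<forall>y \<omega>. m \<le> y \<and> y < m + e \<and> y \<le> 1 \<and> knotoid_diagram (initial_part \<gamma> y \<omega>) \<longrightarrow>
     (\<exists>x \<omega>'. 0 < x \<and> x < m \<and> free_head \<gamma> x \<and> knotoid_diagram (initial_part \<gamma> x \<omega>') \<and>
        plus_welded_move (initial_part \<gamma> y \<omega>) (initial_part \<gamma> x \<omega>'))"
proof -
  have m: "m \<in> {0..1}" "0 < m"
    using free by (auto simp: free_head_def)
  note d1 = proper_curve_velocity(1)[OF \<gamma>] and c0 = proper_curve_velocity(2)[OF \<gamma>]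
    and S2 = proper_curve_velocity(3)[OF \<gamma>] and nz = proper_curve_velocity(4)[OF \<gamma>]
    and orth = proper_curve_velocity(5)[OF \<gamma>]
  obtain A where "\<And>t. t \<in> {0..1} \<Longrightarrow> (velocity \<gamma> has_vector_derivative A t) (at t within {0..1})"
    by (rule proper_curve_acceleration[OF \<gamma>], rule that)
  then have c1: "continuous_on {0..1} (velocity \<gamma>)"
    by (meson continuous_on_eq_continuous_within has_vector_derivative_continuous)
  define p a where "p = \<gamma> m" and "a = velocity \<gamma> m /\<^sub>R norm (velocity \<gamma> m)"
  obtain b where "frame p a b"
    using frame_exists[OF S2[OF m(1)] orth[OF m(1)] nz[OF m(1)]] unfolding p_def a_def by blast
  then interpret frame p a b .

  \<comment> \<open>The arc near \<open>m\<close> as a graph over its tangent\<close>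
  define u w where "u = (\<lambda>t. \<gamma> t \<bullet> a)" and "w = (\<lambda>t. \<gamma> t \<bullet> b)"
  have um: "u m = 0" and wm: "w m = 0"
    by (simp_all add: u_def w_def orth' flip: p_def)
  have "0 < velocity \<gamma> m \<bullet> a"
    using nz[OF m(1)] by (simp add: a_def dot_square_norm power2_eq_square)
  then obtain e1 where e1: "e1 > 0" "\<And>t. t \<in> {0..1} \<Longrightarrow> \<bar>t - m\<bar> < e1 \<Longrightarrow> 0 < velocity \<gamma> t \<bullet> a"
    using near_pos[OF continuous_on_inner[OF c1 continuous_on_const] m(1)] by blast
  have "0 < \<gamma> m \<bullet> p"
    using unit by (simp flip: p_def)
  then obtain e2 where e2: "e2 > 0" "\<And>t. t \<in> {0..1} \<Longrightarrow> \<bar>t - m\<bar> < e2 \<Longrightarrow> 0 < \<gamma> t \<bullet> p"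
    using near_pos[OF continuous_on_inner[OF c0 continuous_on_const] m(1)] by blast
  \<comment> \<open>The halves give strict inequalities and keep \<open>l\<close> positive; on
    \<open>{l..r}\<close> both the tangential velocity and the height are positive.\<close>
  define \<eta> where "\<eta> = min (min e1 e2 / 2) (m / 2)"
  define l r where "l = m - \<eta>" and "r = min 1 (m + \<eta>)"
  have \<eta>: "0 < \<eta>" "\<eta> < e1" "\<eta> < e2" "\<eta> < m"
    using e1(1) e2(1) m by (auto simp: \<eta>_def)
  have lr: "0 < l" "l < m" "m \<le> r" "r \<le> 1" "l < r"
    using \<eta> m by (auto simp: l_def r_def)
  have near: "t \<in> {0..1} \<and> \<bar>t - m\<bar> < e1 \<and> \<bar>t - m\<bar> < e2" if "t \<in> {l..r}" for t
    using that \<eta> lr by (auto simp: l_def r_def)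
  have u_less: "u s < u t" if "l \<le> s" "s < t" "t \<le> r" for s t
    unfolding u_def
    by (rule increasing_from_derivative[of _ "\<lambda>t. velocity \<gamma> t \<bullet> a" l r])
       (use that d1 near e1 lr in \<open>auto intro: inner_has_real_derivative\<close>)
  have cu: "continuous_on {l..r} u" and cw: "continuous_on {l..r} w"
    unfolding u_def w_def using near
    by (auto intro!: continuous_intros continuous_on_subset[OF c0])
  have inj: "inj_on u {l..r}"
    using u_less by (metis atLeastAtMost_iff inj_onI less_irrefl linorder_neqE_linordered_idom)
  define g where "g = the_inv_into {l..r} u"
  have gu: "g (u t) = t" if "t \<in> {l..r}" for t
    using the_inv_into_f_f[OF inj that] by (simp add: g_def)
  have range: "\<exists>t\<in>{l..r}. u t = x" if "x \<in> {u l..u r}" for x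
    using IVT'[of u l x r] cu that lr by auto
  have ug: "u (g x) = x \<and> g x \<in> {l..r}" if "x \<in> {u l..u r}" for x
    using range[OF that] gu by auto
  have img: "{u l..u r} \<subseteq> u ` {l..r}"
    using range by blast
  have cg: "continuous_on {u l..u r} g"
    by (rule continuous_on_subset[OF continuous_on_inv[OF cu _] img]) (use gu in auto)
  \<comment> \<open>Clamping the argument to \<open>{u l..u r}\<close> extends the graph function
    continuously to the whole line, as \<open>graph_push\<close> requires.\<close>
  define f where "f = (\<lambda>x. w (g (max (u l) (min (u r) x))))"
  have ulr: "u l < 0" "0 \<le> u r" "u l < u r"
    using u_less[of l m] u_less[of m r] um lr by (cases "m = r"; auto)+
  have cf: "continuous_on UNIV f"
    unfolding f_def
  proof (rule continuous_on_compose2[OF cw])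
    show "continuous_on UNIV (\<lambda>x. g (max (u l) (min (u r) x)))"
      by (rule continuous_on_compose2[OF cg]) (use ulr in \<open>auto intro!: continuous_intros\<close>)
    show "range (\<lambda>x. g (max (u l) (min (u r) x))) \<subseteq> {l..r}"
      using ug ulr by auto
  qed
  have fu: "f (u t) = w t" if "t \<in> {l..r}" for t
  proof -
    have "u l \<le> u t" "u t \<le> u r"
      using u_less[of l t] u_less[of t r] that by (cases "t = l"; cases "t = r"; auto)+
    then show ?thesis using gu[OF that] by (simp add: f_def)
  qed
  have f0: "f 0 = 0"
    using fu[of m] um wm lr by simp

  \<comment> \<open>The support of the push\<close>
  obtain \<delta>1 where \<delta>1: "\<delta>1 > 0" "\<And>x. \<bar>x\<bar> < \<delta>1 \<Longrightarrow> \<bar>f x\<bar> < 1/2"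
  proof -
    have "\<exists>d>0. \<forall>x\<in>UNIV. dist x 0 < d \<longrightarrow> dist (f x) (f 0) < 1/2"
      using cf unfolding continuous_on_iff by (metis UNIV_I half_gt_zero zero_less_one)
    then show thesis using that f0 by (auto simp: dist_real_def)
  qed
  \<comment> \<open>\<open>F\<close> is the quantity in which the support is measured. On the
    compact set \<open>C\<close> it cannot vanish: a zero would be \<open>p\<close> itself, hence an
    earlier passage through the free head.\<close>
  define F where "F = (\<lambda>q. \<bar>q \<bullet> a\<bar> + \<bar>q \<bullet> b - f (q \<bullet> a)\<bar>)"
  define C where "C = \<gamma> ` {0..l} \<inter> {q. 0 \<le> q \<bullet> p}"
  obtain \<epsilon>2 where \<epsilon>2: "\<epsilon>2 > 0" "\<And>q. q \<in> C \<Longrightarrow> \<epsilon>2 \<le> F q"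
  proof (cases "C = {}")
    case False
    have "compact C"
      unfolding C_def
      by (intro compact_Int_closed compact_continuous_image closed_Collect_le continuous_intros
          continuous_on_subset[OF c0] compact_Icc) (use lr in auto)
    moreover have "continuous_on C F"
      unfolding F_def by (intro continuous_intros continuous_on_compose2[OF cf]) auto
    ultimately obtain q where q: "q \<in> C" "\<And>q'. q' \<in> C \<Longrightarrow> F q \<le> F q'"
      using continuous_attains_inf[of C F] False by blast
    have "F q \<noteq> 0"
    proof
      assume "F q = 0"
      then have "q \<bullet> a = 0 \<and> q \<bullet> b = f (q \<bullet> a)"
        unfolding F_def by linarith
      then have z: "q \<bullet> a = 0" "q \<bullet> b = 0"
        using f0 by auto
      obtain t where t: "t \<in> {0..l}" "q = \<gamma> t" "0 \<le> q \<bullet> p"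
        using q(1) by (auto simp: C_def)
      have "q = p"
        by (rule S2_eqI) (use S2[of t] p_in_S2 t z lr orth' unit in auto)
      then show False
        using free t lr by (auto simp: free_head_def p_def)
    qed
    then have "F q > 0" by (simp add: F_def less_le)
    then show thesis using that q(2) by blast
  qed (use that[of 1] in auto)
  \<comment> \<open>\<open>\<delta>1\<close> and 1/4 put the support into the open unit disc;
    \<open>\<epsilon>2\<close> fixes the curve up to \<open>l\<close>; \<open>- u l\<close> makes
    the shift along the graph trivial at \<open>u l\<close>, where the two pieces of
    \<open>\<theta>\<close> meet.\<close>
  define \<epsilon> where "\<epsilon> = min (min \<delta>1 (1/4)) (min \<epsilon>2 (- u l))"
  have eps: "0 < \<epsilon>" "\<epsilon> \<le> \<delta>1" "\<epsilon> \<le> 1/4" "\<epsilon> \<le> \<epsilon>2" "\<epsilon> \<le> - u l"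
    using \<delta>1(1) \<epsilon>2(1) ulr by (auto simp: \<epsilon>_def)
  interpret graph_push p a b f \<epsilon> "\<epsilon> / 2"
  proof
    fix x z assume *: "\<bar>x\<bar> + \<bar>z - f x\<bar> < \<epsilon>"
    then have "\<bar>x\<bar> < 1/4" "\<bar>f x\<bar> < 1/2" using eps \<delta>1(2)[of x] by linarith+
    then have "\<bar>x\<bar> \<le> 1/4" "\<bar>z\<bar> \<le> 3/4" using * eps by linarith+
    then have "x\<^sup>2 \<le> (1/4)\<^sup>2" "z\<^sup>2 \<le> (3/4)\<^sup>2"
      by (metis abs_ge_zero power2_abs power_mono)+
    then show "x\<^sup>2 + z\<^sup>2 < 1" by (simp add: power2_eq_square)
  qed (use cf eps in auto)
  define \<delta> where "\<delta> = \<epsilon> / 2"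
  have \<delta>: "0 \<le> \<delta>" "\<delta> \<le> \<epsilon> / 2" "0 < \<delta>" using eps by (auto simp: \<delta>_def)

  \<comment> \<open>The push as a reparametrisation of the curve\<close>
  define T where "T = shift \<delta> 0"
  have T_less: "x < y \<Longrightarrow> T x < T y" for x y
    unfolding T_def by (rule shift_less[OF \<delta>(1,2)])
  have T_le: "T x \<le> x" for x
    unfolding T_def by (rule shift_le[OF \<delta>(1)])
  have Tl: "T (u l) = u l"
    unfolding T_def by (rule shift_id) (use eps ulr in auto)
  have cT: "continuous_on S T" for S
    unfolding T_def shift_def using eps by (intro continuous_intros) auto
  have u_ge: "u l \<le> u t" "u t \<le> u r" if "t \<in> {l..r}" for t
    using u_less[of l t] u_less[of t r] that by (cases "t = l"; cases "t = r"; auto)+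
  have Tu: "T (u t) \<in> {u l..u r}" if "t \<in> {l..r}" for t
    using T_less[of "u l" "u t"] T_le[of "u t"] Tl u_ge[OF that] by (cases "u t = u l") auto
  \<comment> \<open>On the graph the push is \<open>T\<close> in the coordinate \<open>u\<close>, so
    the curve slides along itself; \<open>\<theta>\<close> records this motion in the parameter of
    \<open>\<gamma>\<close>.\<close>
  define \<theta> where "\<theta> = (\<lambda>t. if t \<le> l then t else g (T (u t)))"
  have \<theta>: "\<theta> t \<in> {l..r}" "u (\<theta> t) = T (u t)" if "t \<in> {l..r}" for t
    using ug[OF Tu[OF that]] that Tl lr by (auto simp: \<theta>_def)
  have \<theta>_gt: "l < \<theta> t" if "l < t" "t \<le> r" for t
  proof -
    have "u l < u (\<theta> t)"
      using \<theta>[of t] T_less[OF u_less[of l t]] Tl that by auto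
    then show ?thesis
      using \<theta>(1)[of t] that by (cases "\<theta> t = l") auto
  qed
  have \<theta>_less: "\<theta> s < \<theta> t" if "s < t" "t \<le> r" for s t
  proof -
    consider "t \<le> l" | "s \<le> l" "l < t" | "l < s" by linarith
    then show ?thesis
    proof cases
      case 1 then show ?thesis using that by (simp add: \<theta>_def)
    next
      case 2 then show ?thesis using \<theta>_gt[of t] that by (simp add: \<theta>_def)
    next
      case 3
      have "u (\<theta> s) < u (\<theta> t)"
        using \<theta>[of s] \<theta>[of t] T_less[OF u_less[of s t]] 3 that by auto
      moreover have "u (\<theta> t) \<le> u (\<theta> s)" if "\<theta> t \<le> \<theta> s"
        using u_less[of "\<theta> t" "\<theta> s"] \<theta>(1)[of s] \<theta>(1)[of t] 3 that \<open>s < t\<close> \<open>t \<le> r\<close>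
        by (cases "\<theta> s = \<theta> t") auto
      ultimately show ?thesis by force
    qed
  qed
  have h: "flow \<delta> (\<gamma> t) = \<gamma> (\<theta> t)" if t: "t \<in> {0..r}" for t
  proof (cases "t \<le> l")
    case True
    have "flow \<delta> (\<gamma> t) = \<gamma> t"
    proof (rule flow_id)
      show "\<gamma> t \<in> S2" using S2[of t] t lr by auto
      assume "0 \<le> \<gamma> t \<bullet> p"
      then have "\<gamma> t \<in> C" using True t by (auto simp: C_def)
      then show "\<epsilon> \<le> \<bar>\<gamma> t \<bullet> a\<bar> + \<bar>\<gamma> t \<bullet> b - f (\<gamma> t \<bullet> a)\<bar>"
        using \<epsilon>2(2)[of "\<gamma> t"] eps unfolding F_def by linarith
    qed
    then show ?thesis using True by (simp add: \<theta>_def)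
  next
    case False
    then have t': "t \<in> {l..r}" using t by auto
    have pos: "0 \<le> \<gamma> t \<bullet> p" using e2(2)[of t] near[OF t'] by auto
    have px: "px \<delta> (\<gamma> t \<bullet> a) (\<gamma> t \<bullet> b) = u (\<theta> t)"
      using fu[OF t'] \<theta>(2)[OF t'] by (simp add: px_def T_def u_def w_def)
    have py: "py \<delta> (\<gamma> t \<bullet> a) (\<gamma> t \<bullet> b) = w (\<theta> t)"
      using fu[OF t'] fu[OF \<theta>(1)[OF t']] unfolding py_def px by (simp add: u_def w_def)
    show ?thesis
    proof (rule S2_eqI)
      show "flow \<delta> (\<gamma> t) \<in> S2"
        using flow_in_S2[OF \<delta>(1,2)] S2 near[OF t'] by blast
      show "\<gamma> (\<theta> t) \<in> S2"
        using S2 near[OF \<theta>(1)[OF t']] by blast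
      show "0 \<le> flow \<delta> (\<gamma> t) \<bullet> p"
        using flow_height[OF \<delta>(1,2)] S2 near[OF t'] pos by blast
      show "0 \<le> \<gamma> (\<theta> t) \<bullet> p"
        using e2(2)[of "\<theta> t"] near[OF \<theta>(1)[OF t']] by auto
    qed (use flow_coordinates[OF pos, of \<delta>] px py in \<open>auto simp: u_def w_def\<close>)
  qed
  \<comment> \<open>The tent has full height over \<open>u m = 0\<close>, so
    \<open>T (u m) = - \<delta>\<close>; continuity keeps the sign for heads near
    \<open>m\<close>.\<close>
  have "0 < - T (u m)"
    using \<delta>(3) eps(1) by (simp add: um T_def shift_def)
  moreover have "continuous_on {l..r} (\<lambda>t. - T (u t))"
    by (intro continuous_intros continuous_on_compose2[OF cT cu]) auto
  ultimately obtain e where e: "e > 0" "\<And>t. t \<in> {l..r} \<Longrightarrow> \<bar>t - m\<bar> < e \<Longrightarrow> T (u t) < 0"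
  proof -
    assume "0 < - T (u m)" "continuous_on {l..r} (\<lambda>t. - T (u t))"
    then obtain e where "e > 0" "\<And>t. t \<in> {l..r} \<Longrightarrow> dist t m < e \<Longrightarrow> dist (- T (u t)) (- T (u m)) < - T (u m)"
      unfolding continuous_on_iff using lr by (metis atLeastAtMost_iff less_eq_real_def)
    then show thesis
      by (intro that[of e]) (fastforce simp: dist_real_def)+
  qed
  show ?thesis
  proof (rule exI[of _ "min e \<eta>"], intro conjI allI impI)
    show "0 < min e \<eta>" using e(1) \<eta>(1) by simp
    fix y \<omega>
    assume y: "m \<le> y \<and> y < m + min e \<eta> \<and> y \<le> 1 \<and> knotoid_diagram (initial_part \<gamma> y \<omega>)"
    then have ylr: "y \<in> {l..r}" "l < y" "\<bar>y - m\<bar> < e" "0 < y"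
      using lr by (auto simp: r_def)
    define x where "x = \<theta> y"
    have "u x < u m"
      using e(2)[OF ylr(1,3)] \<theta>(2)[OF ylr(1)] by (simp add: x_def um)
    moreover have "u m \<le> u x" if "m \<le> x"
      using u_less[of m x] \<theta>(1)[OF ylr(1)] lr that by (cases "x = m") (auto simp: x_def)
    ultimately have xm: "x < m" by force
    have x0: "0 < x" using \<theta>(1)[OF ylr(1)] lr by (auto simp: x_def)
    have im: "\<theta> ` {0..y} = {0..x}"
    proof
      have "\<theta> 0 = 0" using lr by (simp add: \<theta>_def)
      then show "\<theta> ` {0..y} \<subseteq> {0..x}"
        using \<theta>_less[of 0] \<theta>_less[of _ y] ylr by (force simp: x_def less_eq_real_def)
      show "{0..x} \<subseteq> \<theta> ` {0..y}"
      proof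
        fix z assume z: "z \<in> {0..x}"
        show "z \<in> \<theta> ` {0..y}"
        proof (cases "z \<le> l")
          case True
          then have "\<theta> z = z" by (simp add: \<theta>_def)
          then show ?thesis using True z ylr by (intro image_eqI[of _ _ z]) auto
        next
          case False
          have zr: "z \<in> {l..r}" using z False \<theta>(1)[OF ylr(1)] by (auto simp: x_def)
          have "u z \<le> T (u y)"
            using u_less[of z x] \<theta>[OF ylr(1)] z False by (cases "z = x") (auto simp: x_def)
          moreover have "T (u l) < u z"
            using u_less[of l z] False zr Tl by auto
          moreover have "continuous_on {l..y} (\<lambda>t. T (u t))"
            by (rule continuous_on_compose2[OF cT continuous_on_subset[OF cu]]) (use ylr in auto)
          ultimately obtain t where t: "t \<in> {l..y}" "T (u t) = u z"
            using IVT'[of "\<lambda>t. T (u t)" l "u z" y] ylr by auto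
          then have tr: "t \<in> {l..r}" using ylr by auto
          have "\<theta> t = z"
            using \<theta>[OF tr] t(2) inj_onD[OF inj, of "\<theta> t" z] zr by auto
          then show ?thesis using t lr by (intro image_eqI[of _ _ t]) auto
        qed
      qed
    qed
    have im': "(\<lambda>t. \<theta> (y * t)) ` {0..1} = {0..x}"
    proof -
      have "(*) y ` {0..1} = {0..y}"
        using ylr by (simp add: image_mult_atLeastAtMost)
      then show ?thesis using im by (metis image_image)
    qed
    have yt: "y * t \<in> {0..r}" if "t \<in> {0..1}" for t
    proof -
      have "y * t \<le> y" using that ylr by (simp add: mult_left_le)
      also have "y \<le> r" using ylr by simp
      finally show ?thesis using that ylr by simp
    qed
    obtain \<omega>' where "free_head \<gamma> x" "knotoid_diagram (initial_part \<gamma> x \<omega>')"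
      "plus_welded_move (initial_part \<gamma> y \<omega>) (initial_part \<gamma> x \<omega>')"
    proof (rule isotopic_initial_part[OF \<gamma> _ flow_isotopy[folded \<delta>_def], of "initial_part \<gamma> y \<omega>" "\<lambda>t. \<theta> (y * t)" x])
      show "strict_mono_on {0..1} (\<lambda>t. \<theta> (y * t))"
        using \<theta>_less yt ylr by (auto simp: strict_mono_on_def)
      show "flow \<delta> (curve (initial_part \<gamma> y \<omega>) t) = \<gamma> (\<theta> (y * t))" if "t \<in> {0..1}" for t
        using h[OF yt[OF that]] by simp
    qed (use y im' x0 xm m in auto)
    then show "\<exists>x \<omega>'. 0 < x \<and> x < m \<and> free_head \<gamma> x \<and> knotoid_diagram (initial_part \<gamma> x \<omega>') \<and>
        plus_welded_move (initial_part \<gamma> y \<omega>) (initial_part \<gamma> x \<omega>')"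
      using x0 xm by blast
  qed
qed

text \<open>On the unit sphere, the second derivative of the height \<open>\<gamma> t \<bullet> \<gamma> m\<close> at \<open>m\<close> is
  minus the squared speed.\<close>

lemma height_peak:
  assumes \<gamma>: "proper_curve \<gamma>" and m: "m \<in> {0..1}"
  obtains e where "e > 0"
    "\<And>s t. s \<in> {0..1} \<Longrightarrow> m - e < s \<Longrightarrow> s < t \<Longrightarrow> t \<le> m \<Longrightarrow> \<gamma> s \<bullet> \<gamma> m < \<gamma> t \<bullet> \<gamma> m"
    "\<And>s t. t \<in> {0..1} \<Longrightarrow> m \<le> s \<Longrightarrow> s < t \<Longrightarrow> t < m + e \<Longrightarrow> \<gamma> t \<bullet> \<gamma> m < \<gamma> s \<bullet> \<gamma> m"
proof -
  let ?p = "\<gamma> m"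
  note d1 = proper_curve_velocity(1)[OF \<gamma>] and nz = proper_curve_velocity(4)[OF \<gamma>]
    and orth = proper_curve_velocity(5)[OF \<gamma>]
  obtain A where
    d2: "\<And>t. t \<in> {0..1} \<Longrightarrow> (velocity \<gamma> has_vector_derivative A t) (at t within {0..1})"
    and c2: "continuous_on {0..1} A"
    and curv: "\<And>t. t \<in> {0..1} \<Longrightarrow> A t \<bullet> \<gamma> t = - (velocity \<gamma> t \<bullet> velocity \<gamma> t)"
    by (rule proper_curve_acceleration[OF \<gamma>], rule that)
  have "0 < - (A m \<bullet> ?p)"
    using curv[OF m] nz[OF m] by simp
  then obtain e where e: "e > 0" "\<And>t. t \<in> {0..1} \<Longrightarrow> \<bar>t - m\<bar> < e \<Longrightarrow> 0 < - (A t \<bullet> ?p)"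
    using near_pos[OF continuous_on_minus[OF continuous_on_inner[OF c2 continuous_on_const]] m] by blast
  \<comment> \<open>The derivative of the height decreases strictly through its zero at
    \<open>m\<close>; the zero is the orthogonality of velocity and position.\<close>
  have vel: "- (velocity \<gamma> s \<bullet> ?p) < - (velocity \<gamma> t \<bullet> ?p)"
    if "s \<in> {0..1}" "t \<in> {0..1}" "m - e < s" "s < t" "t < m + e" for s t
  proof (rule increasing_from_derivative[of "\<lambda>t. - (velocity \<gamma> t \<bullet> ?p)" "\<lambda>t. - (A t \<bullet> ?p)" s t])
    show "0 < - (A x \<bullet> ?p)" if "s < x" "x < t" for x
      using e(2)[of x] that \<open>s \<in> _\<close> \<open>t \<in> _\<close> \<open>m - e < s\<close> \<open>t < m + e\<close> by auto
  qed (use that d2 in \<open>auto intro!: DERIV_minus inner_has_real_derivative\<close>)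
  have "\<gamma> s \<bullet> ?p < \<gamma> t \<bullet> ?p" if "s \<in> {0..1}" "m - e < s" "s < t" "t \<le> m" for s t
  proof (rule increasing_from_derivative[of "\<lambda>t. \<gamma> t \<bullet> ?p" "\<lambda>t. velocity \<gamma> t \<bullet> ?p" s t])
    show "0 < velocity \<gamma> x \<bullet> ?p" if "s < x" "x < t" for x
      using vel[of x m] orth[OF m] that \<open>s \<in> _\<close> \<open>t \<le> m\<close> \<open>m - e < s\<close> e(1) m by auto
  qed (use that d1 m in \<open>auto intro!: inner_has_real_derivative\<close>)
  moreover have "\<gamma> t \<bullet> ?p < \<gamma> s \<bullet> ?p" if "t \<in> {0..1}" "m \<le> s" "s < t" "t < m + e" for s t
  proof -
    have "- (\<gamma> s \<bullet> ?p) < - (\<gamma> t \<bullet> ?p)"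
    proof (rule increasing_from_derivative[of "\<lambda>t. - (\<gamma> t \<bullet> ?p)" "\<lambda>t. - (velocity \<gamma> t \<bullet> ?p)" s t])
      show "0 < - (velocity \<gamma> x \<bullet> ?p)" if "s < x" "x < t" for x
        using vel[of m x] orth[OF m] that \<open>t \<in> _\<close> \<open>m \<le> s\<close> \<open>t < m + e\<close> e(1) m by auto
    qed (use that d1 m in \<open>auto intro!: DERIV_minus inner_has_real_derivative\<close>)
    then show ?thesis by simp
  qed
  ultimately show ?thesis using that e(1) by blast
qed

text \<open>Applied to the height along each strand at a crossing: a strict peak makes the strand
  meet the cap in one interval and the rim in its two ends.\<close>

lemma level_set:
  fixes g :: "real \<Rightarrow> real"
  assumes "continuous_on {l..r} g" "g l < \<kappa>" "g r < \<kappa>" "\<kappa> < g m" "l \<le> m" "m \<le> r"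
    and inc: "\<And>s t. l \<le> s \<Longrightarrow> s < t \<Longrightarrow> t \<le> m \<Longrightarrow> g s < g t"
    and dec: "\<And>s t. m \<le> s \<Longrightarrow> s < t \<Longrightarrow> t \<le> r \<Longrightarrow> g t < g s"
  obtains s1 s2 where "l < s1" "s1 < m" "m < s2" "s2 < r"
    "\<And>t. t \<in> {l..r} \<Longrightarrow> \<kappa> \<le> g t \<longleftrightarrow> t \<in> {s1..s2}"
    "\<And>t. t \<in> {l..r} \<Longrightarrow> g t = \<kappa> \<longleftrightarrow> t = s1 \<or> t = s2"
proof -
  have "continuous_on {l..m} g" "continuous_on {m..r} g"
    by (rule continuous_on_subset[OF assms(1)]; use assms in auto)+
  then obtain s1 s2 where s: "s1 \<in> {l..m}" "g s1 = \<kappa>" "s2 \<in> {m..r}" "g s2 = \<kappa>"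
    using IVT'[of g l \<kappa> m] IVT2'[of g r \<kappa> m] assms by auto
  have "s1 \<noteq> l" "s1 \<noteq> m" "s2 \<noteq> m" "s2 \<noteq> r" using s assms by auto
  then have strict: "l < s1" "s1 < m" "m < s2" "s2 < r" using s by auto
  have "g t < \<kappa>" if "t \<in> {l..<s1} \<or> t \<in> {s2<..r}" for t
    using that inc[of t s1] dec[of s2 t] s strict by auto
  moreover have "\<kappa> < g t" if "t \<in> {s1<..<s2}" for t
    using that inc[of s1 t] dec[of t s2] s strict by (cases "t \<le> m") auto
  ultimately have "(\<kappa> \<le> g t \<longleftrightarrow> t \<in> {s1..s2}) \<and> (g t = \<kappa> \<longleftrightarrow> t = s1 \<or> t = s2)" if t: "t \<in> {l..r}" for t
  proof -
    assume lt: "\<And>t. t \<in> {l..<s1} \<or> t \<in> {s2<..r} \<Longrightarrow> g t < \<kappa>"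
      and gt: "\<And>t. t \<in> {s1<..<s2} \<Longrightarrow> \<kappa> < g t"
    consider "t < s1 \<or> s2 < t" | "t = s1 \<or> t = s2" | "s1 < t" "t < s2" by linarith
    then show ?thesis
    proof cases
      case 1
      then have "g t < \<kappa>" using lt[of t] t by auto
      then show ?thesis using 1 strict by auto
    next
      case 2
      then show ?thesis using s(2,4) strict by auto
    next
      case 3
      then have "\<kappa> < g t" using gt[of t] by auto
      then show ?thesis using 3 by auto
    qed
  qed
  with strict that show ?thesis by blast
qed

lemma frontier_two_intervals:
  fixes \<alpha> \<beta> c d :: real
  assumes "\<alpha> < \<beta>" "\<beta> < c" "c < d"
  shows "frontier ({c..d} \<union> {\<alpha>..\<beta>}) = {\<alpha>, \<beta>, c, d}"
proof -
  let ?P = "{c..d} \<union> {\<alpha>..\<beta>}"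
  have ends: "x \<notin> interior ?P" if "x \<in> {\<alpha>, \<beta>, c, d}" for x
  proof
    assume "x \<in> interior ?P"
    then obtain e where e: "e > 0" "ball x e \<subseteq> ?P"
      using mem_interior by blast
    \<comment> \<open>A step smaller than the gap: from an end of one interval it leaves that
      interval on one side without reaching the other.\<close>
    define k where "k = min e (c - \<beta>) / 2"
    have "0 < k" "2 * k \<le> e" "2 * k \<le> c - \<beta>" using e assms by (auto simp: k_def)
    then have k: "0 < k" "k < e" "k < c - \<beta>" by linarith+
    then have "x - k \<in> ?P" "x + k \<in> ?P"
      using e by (auto simp: subset_iff dist_real_def)
    with that k assms show False by auto
  qed
  have inner: "{c<..<d} \<union> {\<alpha><..<\<beta>} \<subseteq> interior ?P"
    by (rule interior_maximal) auto
  have fr: "frontier ?P = ?P - interior ?P"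
    by (simp add: frontier_def closed_Un)
  show ?thesis
  proof
    show "frontier ?P \<subseteq> {\<alpha>, \<beta>, c, d}"
    proof
      fix x assume "x \<in> frontier ?P"
      then have "x \<in> ?P" "x \<notin> {c<..<d} \<union> {\<alpha><..<\<beta>}" using fr inner by blast+
      then show "x \<in> {\<alpha>, \<beta>, c, d}" by auto
    qed
    have "{\<alpha>, \<beta>, c, d} \<subseteq> ?P" using assms by auto
    then show "{\<alpha>, \<beta>, c, d} \<subseteq> frontier ?P" using fr ends by blast
  qed
qed

definition simplifies :: "diagram \<Rightarrow> diagram \<Rightarrow> bool" where
  "simplifies = (\<lambda>x y. plus_welded_move x y \<or> crossing_change x y)\<^sup>*\<^sup>*"

text \<open>The shortened diagram has the same trace as \<open>\<gamma>\<close> up to some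
  \<open>x < m\<close>, but it keeps the parametrisation of the longer diagram outside the cap, so
  the two differ by an end move. The trivial isotopy then makes its parametrisation linear. The
  value \<open>y = m\<close> is excluded, as the head would lie on a crossing.\<close>

lemma retract_through_crossing:
  assumes \<gamma>: "proper_curve \<gamma>" and m: "m \<in> {0<..1}" and not_free: "\<not> free_head \<gamma> m"
  shows "\<exists>e>0. \<forall>y \<omega>. m < y \<and> y < m + e \<and> y \<le> 1 \<and> knotoid_diagram (initial_part \<gamma> y \<omega>) \<longrightarrow>
     (\<exists>x \<omega>'. 0 < x \<and> x < m \<and> free_head \<gamma> x \<and> knotoid_diagram (initial_part \<gamma> x \<omega>') \<and>
        simplifies (initial_part \<gamma> y \<omega>) (initial_part \<gamma> x \<omega>'))"
proof -
  note c0 = proper_curve_velocity(2)[OF \<gamma>] and S2 = proper_curve_velocity(3)[OF \<gamma>]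
    and nz = proper_curve_velocity(4)[OF \<gamma>] and orth = proper_curve_velocity(5)[OF \<gamma>]
  have m01: "m \<in> {0..1}" using m by auto

  \<comment> \<open>The two passages through the crossing\<close>
  obtain n where n: "n \<in> {0..<m}" "\<gamma> n = \<gamma> m"
    using not_free m by (auto simp: free_head_def)
  then have n01: "n \<in> {0..1}" and dpm: "(m, n) \<in> double_points \<gamma>" and dpn: "(n, m) \<in> double_points \<gamma>"
    using m by (auto simp: double_points_def)
  have "n \<noteq> 0" "m \<noteq> 1"
    using dpm dpn \<gamma> unfolding proper_curve_def by blast+
  then have n0: "0 < n" "n < m" and m1: "0 < m" "m < 1" using n m by auto
  have partner: "t = u" if "(s, t) \<in> double_points \<gamma>" "(s, u) \<in> double_points \<gamma>" for s t u
    using that \<gamma> unfolding proper_curve_def generic_immersion_def by blast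
  define Z where "Z = fst ` double_points \<gamma>"
  have Z_I: "s \<in> Z" if "(s, t) \<in> double_points \<gamma>" for s t
    using that unfolding Z_def by force
  have "finite Z"
    using \<gamma> by (simp add: Z_def proper_curve_def generic_immersion_def)
  have isolated: "\<exists>e>0. \<forall>t\<in>Z. \<bar>t - q\<bar> < e \<longrightarrow> t = q" for q
  proof -
    have "open (- (Z - {q}))"
      using \<open>finite Z\<close> by (intro open_Compl finite_imp_closed finite_Diff)
    then obtain e where "e > 0" "ball q e \<subseteq> - (Z - {q})"
      using open_contains_ball by blast
    then show ?thesis
      by (intro exI[of _ e]) (auto simp: subset_iff dist_real_def abs_minus_commute)
  qed
  obtain em where em: "em > 0" "\<And>t. t \<in> Z \<Longrightarrow> \<bar>t - m\<bar> < em \<Longrightarrow> t = m"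
    using isolated by blast
  obtain en where en: "en > 0" "\<And>t. t \<in> Z \<Longrightarrow> \<bar>t - n\<bar> < en \<Longrightarrow> t = n"
    using isolated by blast
  define p where "p = \<gamma> m"
  have p: "p \<in> S2" using S2 m01 by (simp add: p_def)
  obtain b where "frame p (velocity \<gamma> m /\<^sub>R norm (velocity \<gamma> m)) b"
    using frame_exists[OF S2[OF m01] orth[OF m01] nz[OF m01]] unfolding p_def by blast
  then interpret frame p "velocity \<gamma> m /\<^sub>R norm (velocity \<gamma> m)" b .

  \<comment> \<open>The choice of the cap\<close>
  define H where "H = (\<lambda>t. \<gamma> t \<bullet> p)"
  have cH: "continuous_on {0..1} H"
    unfolding H_def by (intro continuous_intros c0)
  have Hm: "H m = 1" and Hn: "H n = 1"
    using unit n by (simp_all add: H_def p_def)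
  \<comment> \<open>Equality in the Cauchy-Schwarz inequality would give
    \<open>\<gamma> t = p\<close>, a third passage through the double point.\<close>
  have H_lt: "H t < 1" if t: "t \<in> {0..1}" "t \<noteq> m" "t \<noteq> n" for t
  proof -
    have le: "H t \<le> 1"
      using norm_cauchy_schwarz[of "\<gamma> t" p] S2[OF t(1)] p by (simp add: H_def)
    moreover have "H t \<noteq> 1"
    proof
      assume "H t = 1"
      then have "\<gamma> t = p"
        using S2[OF t(1)] p by (metis H_def norm_cauchy_schwarz_eq mem_sphere_0 mult_1 scaleR_one)
      then have "(m, t) \<in> double_points \<gamma>"
        using t m01 by (auto simp: double_points_def p_def)
      then show False using partner[OF dpm] t by blast
    qed
    ultimately show ?thesis by simp
  qed
  obtain pm where pm: "pm > 0"
    "\<And>s t. s \<in> {0..1} \<Longrightarrow> m - pm < s \<Longrightarrow> s < t \<Longrightarrow> t \<le> m \<Longrightarrow> H s < H t"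
    "\<And>s t. t \<in> {0..1} \<Longrightarrow> m \<le> s \<Longrightarrow> s < t \<Longrightarrow> t < m + pm \<Longrightarrow> H t < H s"
    using height_peak[OF \<gamma> m01] unfolding H_def p_def by metis
  obtain pn where pn: "pn > 0"
    "\<And>s t. s \<in> {0..1} \<Longrightarrow> n - pn < s \<Longrightarrow> s < t \<Longrightarrow> t \<le> n \<Longrightarrow> H s < H t"
    "\<And>s t. t \<in> {0..1} \<Longrightarrow> n \<le> s \<Longrightarrow> s < t \<Longrightarrow> t < n + pn \<Longrightarrow> H t < H s"
    using height_peak[OF \<gamma> n01, unfolded n(2)] unfolding H_def p_def by metis
  \<comment> \<open>A third of the available room: the closed intervals of radius
    \<open>\<eta>\<close> about \<open>n\<close> and \<open>m\<close> are disjoint, lie in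
    \<open>{0..1}\<close>, contain no other crossing parameter, and the height has a strict peak on
    each.\<close>
  define \<eta> where "\<eta> = min (min em en) (min (min pm pn) (min (min n (1 - m)) (m - n))) / 3"
  have "0 < \<eta>" "3 * \<eta> \<le> em" "3 * \<eta> \<le> en" "3 * \<eta> \<le> pm" "3 * \<eta> \<le> pn" "3 * \<eta> \<le> n"
    "3 * \<eta> \<le> 1 - m" "3 * \<eta> \<le> m - n"
    using em(1) en(1) pm(1) pn(1) n0 m1 by (auto simp: \<eta>_def)
  then have \<eta>: "0 < \<eta>" "\<eta> < em" "\<eta> < en" "\<eta> < pm" "\<eta> < pn" "\<eta> < n" "\<eta> < 1 - m" "2 * \<eta> < m - n"
    by linarith+
  have Zm: "t = m" if "t \<in> Z" "\<bar>t - m\<bar> \<le> \<eta>" for t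
    using that em(2)[of t] \<eta> by simp
  have Zn: "t = n" if "t \<in> Z" "\<bar>t - n\<bar> \<le> \<eta>" for t
    using that en(2)[of t] \<eta> by simp
  \<comment> \<open>Parameters at which the curve must be outside the cap. After \<open>m\<close>
    the single value \<open>m + \<eta>\<close> suffices, since the diagrams considered end before
    \<open>c2 < m + \<eta>\<close>; the curve may re-enter the cap later.\<close>
  define C where "C = {0..n - \<eta>} \<union> {n + \<eta>..m - \<eta>} \<union> {m + \<eta>}"
  have C01: "C \<subseteq> {0..1}" and C_ne: "t \<noteq> m \<and> t \<noteq> n" if "t \<in> C" for t
    using \<eta> n0 m1 that by (auto simp: C_def)
  obtain tm where tm: "tm \<in> C" "\<And>t. t \<in> C \<Longrightarrow> H t \<le> H tm"
  proof -
    have "compact C" "C \<noteq> {}" by (auto simp: C_def intro!: compact_Un compact_insert)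
    moreover have "C \<subseteq> {0..1}" using \<eta> n0 m1 by (auto simp: C_def)
    ultimately show thesis
      using continuous_attains_sup[of C H] continuous_on_subset[OF cH] that by blast
  qed
  \<comment> \<open>Midway between the largest height on \<open>C\<close>, or 0 if that is negative,
    and the height 1 of the crossing: positive as \<open>disc_cap\<close> needs, and above all of
    \<open>C\<close>.\<close>
  define \<kappa> where "\<kappa> = (max 0 (H tm) + 1) / 2"
  have Htm: "H tm < 1" using H_lt C01[OF tm(1)] C_ne tm(1) by blast
  have \<kappa>: "0 < \<kappa>" "\<kappa> < 1" using Htm by (auto simp: \<kappa>_def)
  have HC: "H t < \<kappa>" if "t \<in> C" for t
    using tm(2)[OF that] Htm by (auto simp: \<kappa>_def)
  obtain s1 s2 where s: "n - \<eta> < s1" "s1 < n" "n < s2" "s2 < n + \<eta>"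
    "\<And>t. t \<in> {n - \<eta>..n + \<eta>} \<Longrightarrow> \<kappa> \<le> H t \<longleftrightarrow> t \<in> {s1..s2}"
    "\<And>t. t \<in> {n - \<eta>..n + \<eta>} \<Longrightarrow> H t = \<kappa> \<longleftrightarrow> t = s1 \<or> t = s2"
  proof (rule level_set[of "n - \<eta>" "n + \<eta>" H \<kappa> n])
    show "continuous_on {n - \<eta>..n + \<eta>} H"
      by (rule continuous_on_subset[OF cH]) (use \<eta> n0 m1 in auto)
    show "H (n - \<eta>) < \<kappa>" "H (n + \<eta>) < \<kappa>"
      using \<eta> by (auto intro!: HC simp: C_def)
  qed (use \<eta> n0 m1 \<kappa> Hn pn in auto)
  obtain c c2 where c: "m - \<eta> < c" "c < m" "m < c2" "c2 < m + \<eta>"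
    "\<And>t. t \<in> {m - \<eta>..m + \<eta>} \<Longrightarrow> \<kappa> \<le> H t \<longleftrightarrow> t \<in> {c..c2}"
    "\<And>t. t \<in> {m - \<eta>..m + \<eta>} \<Longrightarrow> H t = \<kappa> \<longleftrightarrow> t = c \<or> t = c2"
  proof (rule level_set[of "m - \<eta>" "m + \<eta>" H \<kappa> m])
    show "continuous_on {m - \<eta>..m + \<eta>} H"
      by (rule continuous_on_subset[OF cH]) (use \<eta> n0 m1 in auto)
    show "H (m - \<eta>) < \<kappa>" "H (m + \<eta>) < \<kappa>"
      using \<eta> by (auto intro!: HC simp: C_def)
  qed (use \<eta> n0 m1 \<kappa> Hm pm in auto)
  have ord: "0 < s1" "s1 < s2" "s2 < c" "0 < c" "c < 1" "c2 < 1"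
    using s(1-4) c(1-4) \<eta> n0 m1 by auto
  have level: "(\<kappa> \<le> H t \<longleftrightarrow> t \<in> {s1..s2} \<or> c \<le> t) \<and> (H t = \<kappa> \<longleftrightarrow> t \<in> {s1, s2, c})"
    if t: "t \<in> {0..<c2}" for t
  proof -
    consider "t \<in> {0..n - \<eta>}" | "t \<in> {n - \<eta>..n + \<eta>}" | "t \<in> {n + \<eta>..m - \<eta>}" | "t \<in> {m - \<eta>..m + \<eta>}"
      using t c(4) by fastforce
    then show ?thesis
    proof cases
      case 1
      then have "H t < \<kappa>" by (intro HC) (simp add: C_def)
      then show ?thesis using 1 s(1-4) c(1-4) ord \<eta> n0 by auto
    next
      case 2
      then show ?thesis using s(5,6)[OF 2] s(1-4) c(1-4) \<eta> by auto
    next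
      case 3
      then have "H t < \<kappa>" by (intro HC) (simp add: C_def)
      then show ?thesis using 3 s(1-4) c(1-4) ord \<eta> n0 by auto
    next
      case 4
      then show ?thesis using c(5,6)[OF 4] s(1-4) c(1-4) \<eta> t by auto
    qed
  qed
  have Z_in: "t = m \<or> t = n" if "t \<in> Z" "t \<in> {s1..s2} \<or> t \<in> {c..<c2}" for t
  proof -
    have "\<bar>t - n\<bar> \<le> \<eta> \<or> \<bar>t - m\<bar> \<le> \<eta>"
      using that(2) s(1-4) c(1-4) by auto
    then show ?thesis using Zm Zn that(1) by blast
  qed

  \<comment> \<open>Pulling the head back before the crossing\<close>
  obtain \<sigma> \<sigma>' where \<sigma>: "smooth01 \<sigma>" "\<And>t. (\<sigma> has_real_derivative \<sigma>' t) (at t)"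
    "\<And>t. t \<in> {0..1} \<Longrightarrow> \<sigma>' t > 0" "\<And>t. t \<le> c \<Longrightarrow> \<sigma> t = t" "\<And>t. t > c \<Longrightarrow> \<sigma> t < t"
    using pull_back_exists[OF ord(4,5)] by metis
  have \<sigma>_cont: "isCont \<sigma> t" for t
    using DERIV_isCont[OF \<sigma>(2)] .
  have \<sigma>_less: "\<sigma> s < \<sigma> t" if "0 \<le> s" "s < t" "t \<le> 1" for s t
    by (rule DERIV_pos_imp_increasing[OF that(2)]) (use \<sigma>(2,3) that in force)
  have \<sigma>_le: "\<sigma> t \<le> t" for t
    using \<sigma>(4)[of t] \<sigma>(5)[of t] by (cases "t \<le> c") auto
  have \<sigma>_gt: "c < \<sigma> t" if "c < t" "t \<le> 1" for t
    using \<sigma>_less[of c t] \<sigma>(4)[of c] ord that by auto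
  \<comment> \<open>\<open>\<sigma> m < m\<close> because \<open>m\<close> lies after the entry
    \<open>c\<close> into the cap; by continuity heads slightly beyond \<open>m\<close> are pulled
    below \<open>m\<close> too.\<close>
  obtain e0 where e0: "e0 > 0" "\<And>t. \<bar>t - m\<bar> < e0 \<Longrightarrow> \<sigma> t < m"
  proof -
    have "0 < m - \<sigma> m" using \<sigma>(5)[of m] c by simp
    then obtain e where "e > 0" "\<And>t. \<bar>t - m\<bar> < e \<Longrightarrow> dist (\<sigma> t) (\<sigma> m) < m - \<sigma> m"
      using \<sigma>_cont[of m] unfolding continuous_at_eps_delta dist_real_def by blast
    then show thesis
      by (intro that[of e]) (fastforce simp: dist_real_def)+
  qed
  show ?thesis
  proof (rule exI[of _ "min e0 (c2 - m)"], intro conjI allI impI)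
    show "0 < min e0 (c2 - m)" using e0(1) c by simp
    fix y \<omega>
    assume y': "m < y \<and> y < m + min e0 (c2 - m) \<and> y \<le> 1 \<and> knotoid_diagram (initial_part \<gamma> y \<omega>)"
    then have y: "m < y" "y < c2" "y \<le> 1" "c < y" "0 < y" and \<sigma>y: "\<sigma> y < m"
      using e0(2)[of y] c m1 by auto
    define x where "x = \<sigma> y"
    have x: "c < x" "x < m" "0 < x" "x \<le> 1"
      using \<sigma>_gt[of y] y \<sigma>y ord m1 by (auto simp: x_def)
    have yt: "y * t \<in> {0..y}" if "t \<in> {0..1}" for t
      using that y by (auto simp: mult_left_le)
    have yt01: "y * t \<in> {0..1}" if "t \<in> {0..1}" for t
      using yt[OF that] y(3) unfolding atLeastAtMost_iff by linarith
    have \<sigma>y_less: "\<sigma> (y * s) < \<sigma> (y * t)" if "s \<in> {0..1}" "t \<in> {0..1}" "s < t" for s t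
      by (rule \<sigma>_less) (use that yt01[of s] yt01[of t] y(5) in auto)
    have "\<sigma> z \<in> {0..x}" if "z \<in> {0..y}" for z
      using that \<sigma>_less[of 0 z] \<sigma>_less[of z y] \<sigma>(4)[of 0] ord y
      by (cases "z = 0"; cases "z = y") (auto simp: x_def)
    then have \<sigma>yt: "\<sigma> (y * t) \<in> {0..x}" if "t \<in> {0..1}" for t
      using yt[OF that] by blast
    have free: "free_head \<gamma> x"
      unfolding free_head_def
    proof (intro conjI ballI notI)
      fix t assume "t \<in> {0..<x}" "\<gamma> t = \<gamma> x"
      then have "x \<in> Z"
        using x unfolding Z_def by (force simp: double_points_def)
      then show False using Zm[of x] x c by auto
    qed (use x in auto)

    \<comment> \<open>The two diagrams and their common disc\<close>
    define T J P where "T = {c / y..1}" and "J = {s1 / y..s2 / y}" and "P = T \<union> J"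
    have P_iff: "t \<in> P \<longleftrightarrow> y * t \<in> {s1..s2} \<or> c \<le> y * t" if "t \<in> {0..1}" for t
      using that y by (auto simp: P_def T_def J_def field_simps)
    have cy: "0 < c / y" "c / y < 1" "0 < s1 / y" "s1 / y < s2 / y" "s2 / y < c / y"
      using ord y by (auto simp: divide_strict_right_mono)
    have P01: "P \<subseteq> {0..1}"
      using cy by (auto simp: P_def T_def J_def)
    have fr: "frontier P = {s1 / y, s2 / y, c / y, 1}"
      unfolding P_def T_def J_def using cy by (intro frontier_two_intervals) auto
    have fr_iff: "t \<in> frontier P - {0, 1} \<longleftrightarrow> y * t \<in> {s1, s2, c}" if "t \<in> {0..1}" for t
      using that y cy unfolding fr by (auto simp: field_simps)
    \<comment> \<open>The end segment comes first, as in \<open>end_move\<close>; so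
      \<open>X \<in> \<omega>\<close> says that the end is the upper strand.\<close>
    define X where "X = (m / y, n / y)"
    have X: "X \<in> T \<times> J"
      using c s y by (auto simp: X_def T_def J_def divide_right_mono)
    have yX: "y * fst X = m" "y * snd X = n" using y by (auto simp: X_def)
    define ce where "ce = (\<lambda>t. \<gamma> (\<sigma> (y * t)))"
    define cd where "cd = (\<lambda>t. \<gamma> (y * t))"
    have dp_cd: "(y * s, y * t) \<in> double_points \<gamma>" if "(s, t) \<in> double_points cd" for s t
      using that yt01[of s] yt01[of t] y unfolding double_points_def cd_def by auto
    have dp_ce: "(\<sigma> (y * s), \<sigma> (y * t)) \<in> double_points \<gamma>" if "(s, t) \<in> double_points ce" for s t
    proof -
      have st: "s \<in> {0..1}" "t \<in> {0..1}" "s \<noteq> t" "ce s = ce t"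
        using that by (auto simp: double_points_def)
      have "\<sigma> (y * s) \<noteq> \<sigma> (y * t)"
        using \<sigma>y_less[of s t] \<sigma>y_less[of t s] st(1-3) by (cases "s < t") auto
      then show ?thesis
        using st \<sigma>yt[OF st(1)] \<sigma>yt[OF st(2)] x by (auto simp: double_points_def ce_def)
    qed
    have in_cd: "(s, t) = X \<or> (t, s) = X" if "(s, t) \<in> double_points cd" "s \<in> P" for s t
    proof -
      have s01: "s \<in> {0..1}" using P01 that(2) by auto
      have "y * s = m \<or> y * s = n"
      proof (rule Z_in[OF Z_I[OF dp_cd[OF that(1)]]])
        show "y * s \<in> {s1..s2} \<or> y * s \<in> {c..<c2}"
          using P_iff[OF s01] that(2) yt[OF s01] y(2) by auto
      qed
      then have "y * s = m \<and> y * t = n \<or> y * s = n \<and> y * t = m"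
        using dp_cd[OF that(1)] partner dpm dpn by metis
      then show ?thesis using y by (auto simp: X_def field_simps)
    qed
    \<comment> \<open>\<open>\<sigma>\<close> is the identity up to \<open>c\<close> and preserves
      being after \<open>c\<close>, so both curves meet the cap and its rim at the same
      parameters.\<close>
    have "(\<sigma> z \<in> {s1..s2} \<or> c \<le> \<sigma> z \<longleftrightarrow> z \<in> {s1..s2} \<or> c \<le> z) \<and>
        (\<sigma> z \<in> {s1, s2, c} \<longleftrightarrow> z \<in> {s1, s2, c})" if "z \<in> {0..1}" for z
    proof (cases "z \<le> c")
      case True
      then show ?thesis using \<sigma>(4)[OF True] by simp
    next
      case False
      then have "c < z" "c < \<sigma> z" using \<sigma>_gt[of z] that by auto
      then show ?thesis using ord by auto
    qed
    then have level_\<sigma>: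
      "\<sigma> (y * t) \<in> {s1..s2} \<or> c \<le> \<sigma> (y * t) \<longleftrightarrow> y * t \<in> {s1..s2} \<or> c \<le> y * t"
      "\<sigma> (y * t) \<in> {s1, s2, c} \<longleftrightarrow> y * t \<in> {s1, s2, c}" if "t \<in> {0..1}" for t
      using yt01[OF that] by blast+
    \<comment> \<open>Inside the cap the only crossing parameters of \<open>\<gamma>\<close> are
      \<open>n\<close> and \<open>m\<close>, and the shortened curve stops at
      \<open>x < m\<close>.\<close>
    have in_ce: "s \<notin> P" if "(s, t) \<in> double_points ce" for s t
    proof
      assume "s \<in> P"
      then have s01: "s \<in> {0..1}" using P01 by auto
      have t01: "t \<in> {0..1}" using that by (auto simp: double_points_def)
      have "\<sigma> (y * s) \<in> {s1..s2} \<or> \<sigma> (y * s) \<in> {c..<c2}"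
        using level_\<sigma>(1)[OF s01] P_iff[OF s01] \<open>s \<in> P\<close> \<sigma>yt[OF s01] x c by auto
      then have "\<sigma> (y * s) = m \<or> \<sigma> (y * s) = n"
        by (rule Z_in[OF Z_I[OF dp_ce[OF that]]])
      then have "\<sigma> (y * s) = m \<or> \<sigma> (y * t) = m"
        using partner[OF dpn] dp_ce[OF that] by auto
      then show False
        using \<sigma>yt[OF s01] \<sigma>yt[OF t01] x by auto
    qed
    have X_dp: "X \<in> double_points cd"
      using n0 m1 y n by (auto simp: X_def double_points_def cd_def)
    let ?B = "{q \<in> S2. \<kappa> \<le> q \<bullet> p}" and ?K = "{q \<in> S2. q \<bullet> p = \<kappa>}"
    have outside: "ce t = cd t" if "t \<in> {0..1} - P" for t
      using that P_iff[of t] \<sigma>(4)[of "y * t"] by (auto simp: ce_def cd_def)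
    have proper_e: "proper_curve ce"
      unfolding ce_def
    proof (rule proper_curve_compose[OF \<gamma>, where \<phi>' = "\<lambda>t. \<sigma>' (y * t) * y"])
      show "smooth01 (\<lambda>t. \<sigma> (y * t))"
        by (rule smooth01_compose[OF \<sigma>(1) smooth01_linear]) (use yt01 in blast)
      show "strict_mono_on {0..1} (\<lambda>t. \<sigma> (y * t))"
        using \<sigma>y_less by (auto intro: strict_mono_onI)
      show "((\<lambda>t. \<sigma> (y * t)) has_real_derivative \<sigma>' (y * t) * y) (at t within {0..1})" for t
        by (rule has_field_derivative_at_within, rule DERIV_chain2[OF \<sigma>(2)])
           (auto intro!: derivative_eq_intros)
      show "0 < \<sigma>' (y * t) * y" if "t \<in> {0..1}" for t
        by (rule mult_pos_pos[OF \<sigma>(3)[OF yt01[OF that]] y(5)])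
    qed (use \<sigma>(4)[of 0] ord free in \<open>auto simp: x_def\<close>)
    \<comment> \<open>The only crossing of \<open>d\<close> with a parameter in \<open>P\<close> is
      \<open>X\<close>, so removing \<open>P \<times> P\<close> discards exactly its data.\<close>
    define d e where "d = (\<lambda>\<omega>. initial_part \<gamma> y \<omega>)" and "e = (\<lambda>\<omega>. \<lparr>curve = ce, over = \<omega> - P \<times> P\<rparr>)"
    have d_simps: "curve (d \<omega>) = cd" "over (d \<omega>) = \<omega>" for \<omega>
      by (simp_all add: d_def cd_def)
    have e_simps: "curve (e \<omega>) = ce" "over (e \<omega>) = \<omega> - P \<times> P" for \<omega>
      by (simp_all add: e_def)
    have knot_e: "knotoid_diagram (e \<omega>)" if "knotoid_diagram (d \<omega>)" for \<omega>
      unfolding knotoid_diagram_iff e_simps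
    proof (intro conjI allI impI subsetI)
      fix z assume z: "z \<in> \<omega> - P \<times> P"
      obtain s t where st: "z = (s, t)" by (cases z)
      have dp: "(s, t) \<in> double_points cd" "(t, s) \<in> double_points cd"
        using z that st double_points_sym unfolding knotoid_diagram_iff d_simps by blast+
      have "s \<notin> P \<and> t \<notin> P"
        using in_cd[OF dp(1)] in_cd[OF dp(2)] X z st unfolding P_def by blast
      then show "z \<in> double_points ce"
        using dp(1) outside[of s] outside[of t] st by (auto simp: double_points_def)
    next
      fix s t assume "(s, t) \<in> \<omega> - P \<times> P"
      then show "(t, s) \<notin> \<omega> - P \<times> P"
        using that unfolding knotoid_diagram_iff d_simps by blast
    qed (use proper_e in auto)
    have disc: "differ_in_disc P (e \<omega>) (d \<omega>)" for \<omega>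
      unfolding differ_in_disc_def
    proof (rule conjI, rule exI[of _ ?B], rule exI[of _ ?K], intro conjI ballI)
      show "disc_with_boundary ?B ?K"
        by (rule disc_cap[OF \<kappa>])
      fix z assume z: "z \<in> {e \<omega>, d \<omega>}"
      \<comment> \<open>A common notation that treats both curves at once: each is
        \<open>\<gamma>\<close> after \<open>\<phi>\<close>.\<close>
      define \<phi> where "\<phi> = (if curve z = ce then (\<lambda>t. \<sigma> (y * t)) else (\<lambda>t. y * t))"
      have cz: "curve z = (\<lambda>t. \<gamma> (\<phi> t))"
        using z by (auto simp: \<phi>_def d_simps e_simps ce_def cd_def)
      have \<phi>: "\<phi> t \<in> {0..<c2}" "\<phi> t \<in> {s1..s2} \<or> c \<le> \<phi> t \<longleftrightarrow> t \<in> P"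
         "\<phi> t \<in> {s1, s2, c} \<longleftrightarrow> t \<in> frontier P - {0, 1}" if t: "t \<in> {0..1}" for t
      proof -
        have eq: "\<phi> t = \<sigma> (y * t) \<or> \<phi> t = y * t" by (simp add: \<phi>_def)
        show "\<phi> t \<in> {0..<c2}"
          using eq yt[OF t] \<sigma>yt[OF t] x(2) y(2) c(3) by auto
        show "\<phi> t \<in> {s1..s2} \<or> c \<le> \<phi> t \<longleftrightarrow> t \<in> P"
          using eq level_\<sigma>(1)[OF t] unfolding P_iff[OF t] by metis
        show "\<phi> t \<in> {s1, s2, c} \<longleftrightarrow> t \<in> frontier P - {0, 1}"
          using eq level_\<sigma>(2)[OF t] unfolding fr_iff[OF t] by metis
      qed
      have S: "curve z t \<in> S2" "curve z t \<bullet> p = H (\<phi> t)" if "t \<in> {0..1}" for t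
      proof -
        have "\<phi> t \<in> {0..1}" using \<phi>(1)[OF that] ord(6) by auto
        then show "curve z t \<in> S2" unfolding cz by (rule S2)
        show "curve z t \<bullet> p = H (\<phi> t)" unfolding cz H_def ..
      qed
      show "{t \<in> {0..1}. curve z t \<in> ?B} = P"
      proof (rule set_eqI)
        fix t
        have "curve z t \<in> ?B \<longleftrightarrow> t \<in> P" if t: "t \<in> {0..1}"
          using S[OF t] \<phi>(2)[OF t] level[OF \<phi>(1)[OF t]] by simp
        then show "t \<in> {t \<in> {0..1}. curve z t \<in> ?B} \<longleftrightarrow> t \<in> P"
          using P01 by blast
      qed
      have fr01: "frontier P - {0, 1} \<subseteq> {0..1}" using cy fr by auto
      show "{t \<in> {0..1}. curve z t \<in> ?K} = frontier P - {0, 1}"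
      proof (rule set_eqI)
        fix t
        have "curve z t \<in> ?K \<longleftrightarrow> t \<in> frontier P - {0, 1}" if t: "t \<in> {0..1}"
          using S[OF t] \<phi>(3)[OF t] level[OF \<phi>(1)[OF t]] by simp
        then show "t \<in> {t \<in> {0..1}. curve z t \<in> ?K} \<longleftrightarrow> t \<in> frontier P - {0, 1}"
          using fr01 by blast
      qed
      fix s assume sf: "s \<in> frontier P"
      then have "s \<in> {s1 / y, s2 / y, c / y, 1}" by (simp only: fr)
      then have sP: "s \<in> P" using cy unfolding P_def T_def J_def by auto
      show "\<forall>t. (s, t) \<notin> double_points (curve z)"
      proof (intro allI notI)
        fix t assume dp: "(s, t) \<in> double_points (curve z)"
        have "curve z = ce \<or> curve z = cd"
          using z by (auto simp: d_simps e_simps)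
        then have "(s, t) \<in> double_points cd"
          using dp in_ce sP by metis
        then have "(s, t) = X \<or> (t, s) = X"
          using in_cd sP by blast
        then have "y * s = m \<or> y * s = n" using yX by auto
        moreover have "y * s \<in> {s1, s2, c, y}" using sf y unfolding fr by auto
        ultimately show False using s(2,3) y c(2) ord by auto
      qed
    qed (use outside in \<open>auto simp: d_simps e_simps\<close>)
    have inside_e: "crossings_inside P (e \<omega>) {}" for \<omega>
      using in_ce by (auto simp: crossings_inside_def e_simps)
    have inside_d: "crossings_inside P (d \<omega>) {X}" for \<omega>
    proof -
      have "(snd X, fst X) \<in> double_points cd"
        using X_dp double_points_sym by (metis prod.collapse)
      moreover have "X \<in> P \<times> P" "(snd X, fst X) \<in> P \<times> P"
        using X by (auto simp: P_def)
      ultimately show ?thesis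
        unfolding crossings_inside_def d_simps using in_cd X_dp
        unfolding converse_unfold by (cases X) auto
    qed

    \<comment> \<open>The moves removing the crossing\<close>
    have end_move: "end_move k (e \<omega>) (d \<omega>)" if "k (d \<omega>) X" for k \<omega>
      unfolding end_move_def
    proof (rule exI[of _ T], rule exI[of _ J], rule exI[of _ X], intro conjI)
      show "end_segment T"
        using cy unfolding end_segment_def T_def by blast
      show "strand J"
        unfolding strand_def J_def
        by (rule exI[of _ "s1 / y"], rule exI[of _ "s2 / y"]) (use cy in auto)
      show "T \<inter> J = {}" using cy by (auto simp: T_def J_def)
    qed (use disc inside_e inside_d X that in \<open>auto simp: P_def\<close>)
    \<comment> \<open>If \<open>X \<in> \<omega>\<close>, the end passes over and the move is
      \<open>Phi_plus\<close>; if neither order is recorded, the crossing is virtual and the move is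
      \<open>Omega_v\<close>.\<close>
    have move: "plus_welded_move (d \<omega>) (e \<omega>)" if "knotoid_diagram (d \<omega>)" "X \<in> \<omega> \<or> prod.swap X \<notin> \<omega>" for \<omega>
    proof -
      have "Phi_plus (e \<omega>) (d \<omega>) \<or> Omega_v (e \<omega>) (d \<omega>)"
        unfolding Phi_plus_def Omega_v_def
        using that(2) end_move[of over_crossing \<omega>] end_move[of virtual_crossing \<omega>] X_dp
        by (auto simp: over_crossing_def virtual_crossing_def d_simps)
      then show ?thesis
        using that(1) knot_e[OF that(1)] unfolding plus_welded_move_def by blast
    qed
    have knot_d: "knotoid_diagram (d \<omega>)" using y' by (simp add: d_def)
    have "simplifies (d \<omega>) (e \<omega>)"
    proof (cases "X \<in> \<omega> \<or> prod.swap X \<notin> \<omega>")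
      case True
      then show ?thesis using move[OF knot_d] by (auto simp: simplifies_def)
    next
      case False
      define \<omega>' where "\<omega>' = insert X (\<omega> - {prod.swap X})"
      have swap: "prod.swap X \<noteq> X"
        using n0 y by (auto simp: X_def)
      have knot': "knotoid_diagram (d \<omega>')"
        using knot_d X_dp swap unfolding knotoid_diagram_iff d_simps \<omega>'_def
        by (cases X) auto
      have "crossing_change (d \<omega>) (d \<omega>')"
        unfolding crossing_change_def d_simps
      proof (intro conjI)
        show "\<exists>s t. (s, t) \<in> \<omega> \<and> \<omega>' = insert (t, s) (\<omega> - {(s, t)})"
          by (rule exI[of _ "snd X"], rule exI[of _ "fst X"])
             (use False in \<open>auto simp: \<omega>'_def prod.swap_def\<close>)
      qed (use knot_d knot' in auto)
      moreover have "plus_welded_move (d \<omega>') (e \<omega>')"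
        using move[OF knot'] by (simp add: \<omega>'_def)
      \<comment> \<open>The change of crossing affects only data inside the disc, which
        \<open>e\<close> drops.\<close>
      moreover have "e \<omega>' = e \<omega>"
        using X by (auto simp: e_def \<omega>'_def P_def)
      ultimately show ?thesis
        unfolding simplifies_def by (metis (mono_tags, lifting) converse_rtranclp_into_rtranclp r_into_rtranclp)
    qed
    moreover obtain \<omega>'' where "knotoid_diagram (initial_part \<gamma> x \<omega>'')"
      "plus_welded_move (e \<omega>) (initial_part \<gamma> x \<omega>'')"
    proof (rule isotopic_initial_part[OF \<gamma> knot_e[OF knot_d], of id "\<lambda>t. \<sigma> (y * t)" x])
      show "homotopic_with_canon (\<lambda>f. \<exists>g. homeomorphism S2 S2 f g) S2 S2 id id"
        using homeomorphism_ident by (auto simp: id_def)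
      show "strict_mono_on {0..1} (\<lambda>t. \<sigma> (y * t))"
        using \<sigma>y_less by (auto intro: strict_mono_onI)
      show "(\<lambda>t. \<sigma> (y * t)) ` {0..1} = {0..x}"
      proof
        show "(\<lambda>t. \<sigma> (y * t)) ` {0..1} \<subseteq> {0..x}" using \<sigma>yt by blast
        show "{0..x} \<subseteq> (\<lambda>t. \<sigma> (y * t)) ` {0..1}"
        proof
          fix z assume "z \<in> {0..x}"
          moreover have "\<sigma> 0 = 0" using \<sigma>(4)[of 0] ord by simp
          ultimately obtain t where t: "0 \<le> t" "t \<le> y" "\<sigma> t = z"
            using IVT[of \<sigma> 0 z y] \<sigma>_cont y by (auto simp: x_def)
          then show "z \<in> (\<lambda>t. \<sigma> (y * t)) ` {0..1}"
            using y by (intro image_eqI[of _ _ "t / y"]) auto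
        qed
      qed
    qed (use x in \<open>auto simp: e_simps ce_def\<close>)
    ultimately show "\<exists>x \<omega>'. 0 < x \<and> x < m \<and> free_head \<gamma> x \<and> knotoid_diagram (initial_part \<gamma> x \<omega>') \<and>
        simplifies (initial_part \<gamma> y \<omega>) (initial_part \<gamma> x \<omega>')"
      using free x unfolding simplifies_def d_def by (metis (mono_tags, lifting) rtranclp.rtrancl_into_rtrancl)
  qed
qed

text \<open>Settles the supremum itself when it is a crossing parameter: no diagram is cut
  there.\<close>

lemma free_head_of_knotoid:
  assumes kn: "knotoid_diagram (initial_part \<gamma> x \<omega>)" and x: "0 < x" "x \<le> 1"
  shows "free_head \<gamma> x"
  unfolding free_head_def
proof (intro conjI ballI notI)
  fix s assume s: "s \<in> {0..<x}" "\<gamma> s = \<gamma> x"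
  then have "(1, s / x) \<in> double_points (\<lambda>t. \<gamma> (x * t))"
    using x by (auto simp: double_points_def)
  then show False
    using kn unfolding knotoid_diagram_iff proper_curve_def initial_part_simps by blast
qed fact+

lemma small_initial_part_trivial:
  assumes \<gamma>: "proper_curve \<gamma>"
  obtains x0 where "0 < x0" "x0 \<le> 1"
    "\<And>x \<omega>. 0 < x \<Longrightarrow> x \<le> x0 \<Longrightarrow> knotoid_diagram (initial_part \<gamma> x \<omega>) \<Longrightarrow>
       trivial_diagram (initial_part \<gamma> x \<omega>)"
proof -
  \<comment> \<open>All crossing parameters are positive, so a cut before the least of them is
    embedded. The extra element 1 makes the minimum exist and bounds \<open>x0\<close>.\<close>
  define Z where "Z = insert 1 (fst ` double_points \<gamma>)"
  have Z: "finite Z" "Z \<noteq> {}" "\<And>z. z \<in> Z \<Longrightarrow> 0 < z"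
  proof -
    show "finite Z" using \<gamma> by (simp add: Z_def proper_curve_def generic_immersion_def)
    show "0 < z" if z: "z \<in> Z" for z
    proof (cases "z = 1")
      case False
      then obtain t where t: "(z, t) \<in> double_points \<gamma>"
        using z unfolding Z_def by auto
      moreover from this have "z \<noteq> 0" using \<gamma> unfolding proper_curve_def by blast
      ultimately show ?thesis by (auto simp: double_points_def)
    qed simp
  qed (simp add: Z_def)
  define x0 where "x0 = Min Z / 2"
  have x0: "0 < x0" "\<And>z. z \<in> Z \<Longrightarrow> x0 < z"
  proof -
    have "0 < Min Z" using Z by simp
    then show "0 < x0" by (simp add: x0_def)
    show "x0 < z" if "z \<in> Z" for z
      using Min_le[OF Z(1) that] \<open>0 < Min Z\<close> by (simp add: x0_def)
  qed
  have "x0 \<le> 1" using x0(2)[of 1] by (simp add: Z_def)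
  moreover have "inj_on (\<lambda>t. \<gamma> (x * t)) {0..1}" if x: "0 < x" "x \<le> x0" for x
  proof (rule inj_onI, rule ccontr)
    fix s t :: real assume st: "s \<in> {0..1}" "t \<in> {0..1}" "\<gamma> (x * s) = \<gamma> (x * t)" "s \<noteq> t"
    have le: "x * s \<le> x" "x * t \<le> x" using st x by (auto simp: mult_left_le)
    have "x * s \<in> {0..1}" "x * t \<in> {0..1}"
      using order_trans[OF le(1), of 1] order_trans[OF le(2), of 1] st x \<open>x0 \<le> 1\<close> by auto
    then have "(x * s, x * t) \<in> double_points \<gamma>"
      using st x unfolding double_points_def by simp
    then have "x * s \<in> Z" unfolding Z_def by force
    then show False using x0(2)[of "x * s"] le x by simp
  qed
  ultimately show ?thesis
    using x0(1) by (intro that[of x0]) (auto simp: trivial_diagram_def)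
qed

lemma initial_part_simplifies:
  assumes \<gamma>: "proper_curve \<gamma>" and "knotoid_diagram (initial_part \<gamma> 1 \<omega>)"
  shows "\<exists>e. trivial_diagram e \<and> simplifies (initial_part \<gamma> 1 \<omega>) e"
proof -
  \<comment> \<open>All \<open>\<omega>\<close> are included because the retraction may alter the
    crossing data.\<close>
  define Q where "Q = (\<lambda>x. \<forall>\<omega>. knotoid_diagram (initial_part \<gamma> x \<omega>) \<longrightarrow>
     (\<exists>e. trivial_diagram e \<and> simplifies (initial_part \<gamma> x \<omega>) e))"
  define S where "S = {x \<in> {0<..1}. \<forall>y\<in>{0<..x}. Q y}"
  obtain x0 where x0: "0 < x0" "x0 \<le> 1"
    "\<And>x \<omega>. 0 < x \<Longrightarrow> x \<le> x0 \<Longrightarrow> knotoid_diagram (initial_part \<gamma> x \<omega>) \<Longrightarrow>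
       trivial_diagram (initial_part \<gamma> x \<omega>)"
    using small_initial_part_trivial[OF \<gamma>] by blast
  have "Q y" if "y \<in> {0<..x0}" for y
    unfolding Q_def simplifies_def using x0(3)[of y] that by (metis greaterThanAtMost_iff rtranclp.rtrancl_refl)
  then have "x0 \<in> S" using x0 by (simp add: S_def)
  have bdd: "bdd_above S" by (rule bdd_aboveI[of _ 1]) (simp add: S_def)
  define m where "m = Sup S"
  have m: "0 < m" "m \<le> 1"
  proof -
    have "x0 \<le> m" unfolding m_def by (rule cSup_upper[OF \<open>x0 \<in> S\<close> bdd])
    then show "0 < m" using x0 by simp
    show "m \<le> 1" unfolding m_def by (rule cSup_least) (use \<open>x0 \<in> S\<close> in \<open>auto simp: S_def\<close>)
  qed
  have below: "Q x" if "0 < x" "x < m" for x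
  proof -
    obtain z where "z \<in> S" "x < z"
      using less_cSupD[of S x] \<open>x0 \<in> S\<close> \<open>x < m\<close> unfolding m_def by blast
    then show ?thesis using \<open>0 < x\<close> by (simp add: S_def)
  qed
  have step: "Q y" if red: "\<And>\<omega>. knotoid_diagram (initial_part \<gamma> y \<omega>) \<Longrightarrow>
     \<exists>x \<omega>'. 0 < x \<and> x < m \<and> knotoid_diagram (initial_part \<gamma> x \<omega>') \<and>
        simplifies (initial_part \<gamma> y \<omega>) (initial_part \<gamma> x \<omega>')" for y
    unfolding Q_def
  proof (intro allI impI)
    fix \<omega> assume "knotoid_diagram (initial_part \<gamma> y \<omega>)"
    then obtain x \<omega>' where x: "0 < x" "x < m" "knotoid_diagram (initial_part \<gamma> x \<omega>')"
      "simplifies (initial_part \<gamma> y \<omega>) (initial_part \<gamma> x \<omega>')"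
      using red by blast
    obtain e where "trivial_diagram e" "simplifies (initial_part \<gamma> x \<omega>') e"
      using below[OF x(1,2)] x(3) unfolding Q_def by blast
    then show "\<exists>e. trivial_diagram e \<and> simplifies (initial_part \<gamma> y \<omega>) e"
      using x(4) unfolding simplifies_def by (meson rtranclp_trans)
  qed
  \<comment> \<open>A whole right neighbourhood of \<open>m\<close>, with \<open>m\<close> itself,
    retracts below \<open>m\<close>, where \<open>below\<close> applies.\<close>
  obtain e where e: "e > 0" "\<And>y. m \<le> y \<Longrightarrow> y < m + e \<Longrightarrow> y \<le> 1 \<Longrightarrow> Q y"
  proof (cases "free_head \<gamma> m")
    case True
    obtain e where e: "e > 0" "\<forall>y \<omega>. m \<le> y \<and> y < m + e \<and> y \<le> 1 \<and> knotoid_diagram (initial_part \<gamma> y \<omega>) \<longrightarrow>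
     (\<exists>x \<omega>'. 0 < x \<and> x < m \<and> free_head \<gamma> x \<and> knotoid_diagram (initial_part \<gamma> x \<omega>') \<and>
        plus_welded_move (initial_part \<gamma> y \<omega>) (initial_part \<gamma> x \<omega>'))"
      using retract_free_head[OF \<gamma> True] by blast
    show thesis
    proof (rule that[OF e(1)], rule step)
      fix y \<omega> assume "m \<le> y" "y < m + e" "y \<le> 1" "knotoid_diagram (initial_part \<gamma> y \<omega>)"
      then obtain x \<omega>' where "0 < x" "x < m" "knotoid_diagram (initial_part \<gamma> x \<omega>')"
        "plus_welded_move (initial_part \<gamma> y \<omega>) (initial_part \<gamma> x \<omega>')"
        using e(2) by blast
      moreover from this have "simplifies (initial_part \<gamma> y \<omega>) (initial_part \<gamma> x \<omega>')"
        unfolding simplifies_def by (intro r_into_rtranclp disjI1)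
      ultimately show "\<exists>x \<omega>'. 0 < x \<and> x < m \<and> knotoid_diagram (initial_part \<gamma> x \<omega>') \<and>
        simplifies (initial_part \<gamma> y \<omega>) (initial_part \<gamma> x \<omega>')" by blast
    qed
  next
    case False
    obtain e where e: "e > 0" "\<forall>y \<omega>. m < y \<and> y < m + e \<and> y \<le> 1 \<and> knotoid_diagram (initial_part \<gamma> y \<omega>) \<longrightarrow>
     (\<exists>x \<omega>'. 0 < x \<and> x < m \<and> free_head \<gamma> x \<and> knotoid_diagram (initial_part \<gamma> x \<omega>') \<and>
        simplifies (initial_part \<gamma> y \<omega>) (initial_part \<gamma> x \<omega>'))"
      using retract_through_crossing[OF \<gamma> _ False] m by auto
    show thesis
    proof (rule that[OF e(1)], rule step)
      fix y \<omega> assume y: "m \<le> y" "y < m + e" "y \<le> 1" and kn: "knotoid_diagram (initial_part \<gamma> y \<omega>)"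
      then have "free_head \<gamma> y"
        using m free_head_of_knotoid[OF kn] by simp
      with False have "y \<noteq> m" by auto
      with y have "m < y" by simp
      with y kn show "\<exists>x \<omega>'. 0 < x \<and> x < m \<and> knotoid_diagram (initial_part \<gamma> x \<omega>') \<and>
        simplifies (initial_part \<gamma> y \<omega>) (initial_part \<gamma> x \<omega>')"
        using e(2) by blast
    qed
  qed
  \<comment> \<open>Otherwise \<open>z > m\<close> would belong to \<open>S\<close>. The supremum
    need not be attained, so \<open>Q 1\<close> afterwards comes from the property of
    \<open>e\<close> at \<open>y = m\<close>.\<close>
  have "m = 1"
  proof (rule ccontr)
    assume "m \<noteq> 1"
    define z where "z = min 1 (m + e / 2)"
    have z: "m < z" "z < m + e" "z \<le> 1" using m \<open>m \<noteq> 1\<close> e(1) by (auto simp: z_def)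
    have "Q y" if "0 < y" "y \<le> z" for y
      using below[of y] e(2)[of y] that z by (cases "y < m") auto
    then have "z \<in> S" using z m by (simp add: S_def)
    then have "z \<le> m" unfolding m_def by (rule cSup_upper[OF _ bdd])
    then show False using z by simp
  qed
  then have "Q 1" using e by simp
  then show ?thesis using assms(2) unfolding Q_def by blast
qed

theorem proposition5p1:
  fixes d :: diagram
  assumes "knotoid_diagram d"
  shows "\<exists>e. trivial_diagram e \<and>
    (\<lambda>x y. plus_welded_move x y \<or> crossing_change x y)\<^sup>*\<^sup>* d e"
proof -
  have eq: "initial_part (curve d) 1 (over d) = d"
    by (simp add: initial_part_def)
  have "proper_curve (curve d)"
    using assms knotoid_diagram_iff by blast
  then show ?thesis
    using initial_part_simplifies[of "curve d" "over d", unfolded eq simplifies_def] assms by blast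
qed

end
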